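(* Let $n\ge2$, $\nu=(\nu_1,\dots,\nu_n)\in\mathbb{C}^n$, $\tilde\nu=(\nu_1,\dots,\nu_{n-1})$. Then for all $y=(y_1,\dots,y_n)\in(\mathbb{R}^+)^n$, \[\widetilde W^n_\nu(y)=2^n\int_{(\mathbb{R}^+)^{n-1}}\prod_{i=1}^nK_{2\nu_n}\Bigl(2\pi y_i\sqrt{(1+u_{i-1})(1+1/u_i)}\Bigr)\cdot\widetilde W^{n-1}_{\tilde\nu}\Bigl(y_2\sqrt{\tfrac{u_1}{u_2}},\dots,y_{n-1}\sqrt{\tfrac{u_{n-2}}{u_{n-1}}},y_n\sqrt{u_{n-1}}\Bigr)\prod_{i=1}^{n-1}\frac{du_i}{u_i},\] with the conventions $u_0=0$ and $1/u_n=0$.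
   Context: $K_s$ denotes the modified $K$-Bessel function. The functions $\widetilde W^n_\nu$ on $(\mathbb{R}^+)^n$ ($\nu\in\mathbb{C}^n$) are defined recursively: $\widetilde W^1_{\nu_1}(y_1)=2K_{2\nu_1}(2\pi y_1)$, and for $n\ge2$, with $\tilde\nu=(\nu_1,\dots,\nu_{n-1})$, \[\widetilde W^n_\nu(y)=\int_{(\mathbb{R}^+)^n}\int_{(\mathbb{R}^+)^{n-1}}\prod_{i=1}^n e^{-(\pi y_i)^2t_i-1/t_i}\prod_{i=1}^n(\pi y_i)^{2\nu_n}\prod_{i=1}^{n-1}e^{-(\pi y_i)^2\frac{t_i}{t_{i+1}}u_i-\frac1{u_i}}\; t_1^{2\nu_n}\prod_{i=1}^{n-1}(t_{i+1}u_i)^{\nu_n}\;\widetilde W^{n-1}_{\tilde\nu}(z_1,\dots,z_{n-1})\prod_{i=1}^{n-1}\frac{du_i}{u_i}\prod_{i=1}^n\frac{dt_i}{t_i},\] where $z_i=y_{i+1}\sqrt{\frac{t_{i+1}u_{i+1}}{t_{i+2}u_i}}$ for $1\le i\le n-2$ and $z_{n-1}=y_n\sqrt{t_n/u_{n-1}}$. *)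

theory Defs
  imports "HOL-Analysis.Analysis"
begin

text \<open>
  Vectors \<open>(x\<^sub>1, \<dots>, x\<^sub>n)\<close> are functions on \<^typ>\<open>nat\<close> of which only the values at the
  indices \<open>1, \<dots>, n\<close> are used.  In particular the truncation
  \<open>(\<nu>\<^sub>1, \<dots>, \<nu>\<^sub>n\<^sub>-\<^sub>1)\<close> of \<open>\<nu>\<close> is represented by \<open>\<nu>\<close> itself.
\<close>

text \<open>The measure \<open>dt/t\<close> on the positive reals (the non-positive reals are a null set).\<close>

definition mult_haar :: "real measure" where
  "mult_haar = density lborel (\<lambda>t. ennreal (indicator {0<..} t / t))"

text \<open>The measure \<open>\<Prod>\<^sub>i dt\<^sub>i/t\<^sub>i\<close> on the positive orthant with coordinates indexed by \<open>I\<close>.\<close>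

abbreviation mult_haar_on :: "nat set \<Rightarrow> (nat \<Rightarrow> real) measure" where
  "mult_haar_on I \<equiv> (\<Pi>\<^sub>M i\<in>I. mult_haar)"

text \<open>
  Modified Bessel function of the second kind, of complex order \<open>s\<close> and argument \<open>x > 0\<close>, by
  \<open>K\<^sub>s(x) = 1/2 \<integral>\<^sub>0\<^sup>\<infinity> exp (- x/2 (t + 1/t)) t\<^sup>s dt/t\<close>.
\<close>

definition bessel_K :: "complex \<Rightarrow> real \<Rightarrow> complex" where
  "bessel_K s x =
     1 / 2 * (\<integral>t. of_real (exp (- (x / 2) * (t + 1 / t))) * of_real t powr s \<partial>mult_haar)"

text \<open>
  One step of the recursion, producing a function of \<open>n\<close> variables from a function \<open>V\<close> of
  \<open>n - 1\<close> variables and the parameter \<open>s = \<nu>\<^sub>n\<close>.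
\<close>

definition whittaker_step ::
    "nat \<Rightarrow> complex \<Rightarrow> ((nat \<Rightarrow> real) \<Rightarrow> complex) \<Rightarrow> (nat \<Rightarrow> real) \<Rightarrow> complex" where
  "whittaker_step n s V y =
     (\<integral>t. (\<integral>u.
        (\<Prod>i=1..n. of_real (exp (- (pi * y i)\<^sup>2 * t i - 1 / t i)))
      * (\<Prod>i=1..n. of_real (pi * y i) powr (2 * s))
      * (\<Prod>i=1..n-1. of_real (exp (- (pi * y i)\<^sup>2 * (t i / t (i + 1)) * u i - 1 / u i)))
      * of_real (t 1) powr (2 * s)
      * (\<Prod>i=1..n-1. of_real (t (i + 1) * u i) powr s)
      * V (\<lambda>i. if i \<le> n - 2
               then y (i + 1) * sqrt (t (i + 1) * u (i + 1) / (t (i + 2) * u i))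
               else y n * sqrt (t n / u (n - 1)))
      \<partial>mult_haar_on {1..n-1}) \<partial>mult_haar_on {1..n})"

fun whittaker :: "nat \<Rightarrow> (nat \<Rightarrow> complex) \<Rightarrow> (nat \<Rightarrow> real) \<Rightarrow> complex" where
  "whittaker 0 \<nu> y = undefined"
| "whittaker (Suc 0) \<nu> y = 2 * bessel_K (2 * \<nu> 1) (2 * pi * y 1)"
| "whittaker (Suc (Suc m)) \<nu> y =
     whittaker_step (Suc (Suc m)) (\<nu> (Suc (Suc m))) (whittaker (Suc m) \<nu>) y"

end

theory Submission
  imports Defs
begin

text \<open>
  For fixed \<open>t\<close>, the measure-preserving substitution \<open>v\<^sub>i = t\<^sub>i\<^sub>+\<^sub>1 / u\<^sub>i\<close> removes \<open>t\<close> from the arguments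
  of the lower-rank function and decouples the \<open>t\<^sub>i\<close> in the exponential.  After interchanging the two
  integrals, each integral over \<open>t\<^sub>i\<close> is
  \<open>\<integral> exp (- a t - b / t) t\<^sup>2\<^sup>s dt/t = 2 (b / a)\<^sup>s K\<^sub>2\<^sub>s(2 \<surd>(a b))\<close>, with \<open>b\<^sub>i = 1 + v\<^sub>i\<^sub>-\<^sub>1\<close> and
  \<open>a\<^sub>i = (\<pi> y\<^sub>i)\<^sup>2 (1 + 1 / v\<^sub>i)\<close>, and the powers \<open>(b\<^sub>i / a\<^sub>i)\<^sup>s\<close> telescope against the remaining factors.
  Absolute convergence, needed for the interchange, is carried through the recursion by the bound
  \<open>|V(x)| \<le> C (\<Prod>\<^sub>i (x\<^sub>i + 1 / x\<^sub>i))\<^sup>b\<close>: since \<open>K\<^sub>r(x) = O(x\<^sup>-\<^sup>N)\<close> for every large \<open>N\<close>, the Bessel factors beat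
  any such growth in the integration variables.
\<close>

subsection \<open>The measure dt/t\<close>

lemma sets_mult_haar [simp, measurable_cong]: "sets mult_haar = sets borel"
  by (simp add: mult_haar_def)

lemma space_mult_haar [simp]: "space mult_haar = UNIV"
  by (simp add: mult_haar_def)

interpretation mult_haar: sigma_finite_measure mult_haar
  unfolding mult_haar_def by (subst sigma_finite_measure.sigma_finite_iff_density_finite[OF sigma_finite_lborel]) auto

interpretation mult_haar_prod: product_sigma_finite "\<lambda>_::nat. mult_haar"
  by unfold_locales

lemma sigma_finite_mult_haar_on: "finite I \<Longrightarrow> sigma_finite_measure (mult_haar_on I)"
  by (rule mult_haar_prod.sigma_finite)

lemma AE_mult_haar_pos: "AE t in mult_haar. 0 < t"
  unfolding mult_haar_def by (subst AE_density) (auto simp: indicator_def)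

text \<open>Later identities under the integral sign are checked only at points with positive
  coordinates; this makes that sufficient.\<close>

lemma AE_mult_haar_on_pos:
  assumes "finite I"
  shows "AE x in mult_haar_on I. \<forall>i\<in>I. 0 < x i"
proof (subst AE_finite_all[OF assms], rule ballI)
  fix i assume i: "i \<in> I"
  have nonpos: "emeasure mult_haar {..0} = 0"
    using AE_mult_haar_pos by (subst (asm) AE_iff_measurable[of "{..0}"]) (auto simp: not_less)
  \<comment> \<open>The points with \<open>x i \<le> 0\<close> form a box with one null side. The
    other sides have infinite measure, but \<open>0 * \<infinity> = 0\<close> in
    \<open>ennreal\<close>.\<close>
  have "emeasure (mult_haar_on I) (\<Pi>\<^sub>E j\<in>I. if j = i then {..0} else UNIV) =
      (\<Prod>j\<in>I. emeasure mult_haar (if j = i then {..0} else UNIV))"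
    by (rule mult_haar_prod.emeasure_PiM[OF assms]) auto
  also have "\<dots> = 0"
    using i assms nonpos by (auto intro!: prod_zero)
  finally have "emeasure (mult_haar_on I) (\<Pi>\<^sub>E j\<in>I. if j = i then {..0} else UNIV) = 0" .
  then show "AE x in mult_haar_on I. 0 < x i"
    by (intro AE_I[where N = "\<Pi>\<^sub>E j\<in>I. if j = i then {..0} else UNIV"])
       (auto simp: space_PiM PiE_iff extensional_def assms intro!: sets_PiM_I_finite split: if_splits)
qed

lemma mult_haar_interval:
  assumes "0 < a" "a \<le> b"
  shows "emeasure mult_haar {a<..<b} = ennreal (ln b - ln a)"
proof -
  have "emeasure mult_haar {a<..<b} =
      (\<integral>\<^sup>+t. ennreal (indicator {0<..} t / t) * indicator {a<..<b} t \<partial>lborel)"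
    unfolding mult_haar_def by (subst emeasure_density) auto
  also have "\<dots> = (\<integral>\<^sup>+t. ennreal (1 / t) * indicator {a..b} t \<partial>lborel)"
    using assms AE_lborel_singleton[of a] AE_lborel_singleton[of b]
    by (intro nn_integral_cong_AE) (auto elim!: eventually_elim2 simp: indicator_def)
  also have "\<dots> = ennreal (ln b - ln a)"
    using assms by (intro nn_integral_FTC_Icc) (auto intro!: derivative_eq_intros)
  finally show ?thesis .
qed

text \<open>In the logarithmic coordinate, inversions and dilations of the half-line become
  reflections and translations. Agreement on boxes suffices, by uniqueness of Lebesgue
  measure.\<close>

lemma distr_ln_mult_haar: "distr mult_haar borel ln = lborel"
proof (rule lborel_eqI[symmetric])
  fix l u :: real
  assume "\<And>b. b \<in> Basis \<Longrightarrow> l \<bullet> b \<le> u \<bullet> b"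
  then have lu: "l \<le> u" by simp
  have "emeasure (distr mult_haar borel ln) (box l u) = emeasure mult_haar (ln -` {l<..<u})"
    by (subst emeasure_distr) (auto simp: box_real)
  also have "\<dots> = emeasure mult_haar {exp l<..<exp u}"
  proof (rule emeasure_eq_AE)
    have "t \<in> ln -` {l<..<u} \<longleftrightarrow> t \<in> {exp l<..<exp u}" if "0 < t" for t :: real
      using that by (metis exp_less_cancel_iff exp_ln greaterThanLessThan_iff vimage_eq)
    then show "AE t in mult_haar. t \<in> ln -` {l<..<u} \<longleftrightarrow> t \<in> {exp l<..<exp u}"
      using AE_mult_haar_pos by auto
  qed (use measurable_sets[of ln borel borel "{l<..<u}"] in auto)
  also have "\<dots> = ennreal (u - l)"
    using lu by (subst mult_haar_interval) auto
  finally show "emeasure (distr mult_haar borel ln) (box l u) =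
      ennreal (\<Prod>b\<in>Basis. (u - l) \<bullet> b)"
    by simp
qed simp

lemma mult_haar_eq_distr_exp: "mult_haar = distr lborel borel exp"
proof -
  have "distr lborel borel exp = distr mult_haar borel (exp \<circ> ln)"
    unfolding distr_ln_mult_haar[symmetric] by (subst distr_distr) auto
  \<comment> \<open>\<open>exp \<circ> ln\<close> is the identity at positive arguments, hence
    almost everywhere.\<close>
  also have "\<dots> = distr mult_haar mult_haar (\<lambda>t. t)"
    using AE_mult_haar_pos by (intro distr_cong_AE) auto
  finally show ?thesis by simp
qed

lemma lborel_distr_affine_unit:
  fixes c d :: real
  assumes "\<bar>c\<bar> = 1"
  shows "distr lborel borel (\<lambda>x. d + c * x) = lborel"
  using lborel_real_affine[of c d] assms by (auto simp: density_1)

text \<open>Conjugation by \<open>exp\<close> turns \<open>t \<mapsto> c / t\<close> into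
  \<open>x \<mapsto> ln c - x\<close>, which preserves Lebesgue measure.\<close>

lemma distr_mult_haar_divide:
  assumes "0 < c"
  shows "distr mult_haar mult_haar (\<lambda>t. c / t) = mult_haar"
proof -
  have "distr mult_haar mult_haar (\<lambda>t. c / t) = distr lborel borel ((\<lambda>t. c / t) \<circ> exp)"
    by (subst (1) mult_haar_eq_distr_exp, subst distr_distr) (auto intro!: distr_cong)
  also have "(\<lambda>t. c / t) \<circ> exp = exp \<circ> (\<lambda>x. ln c + (- 1) * x)"
    using assms by (auto simp: fun_eq_iff exp_diff)
  also have "distr lborel borel \<dots> = distr (distr lborel borel (\<lambda>x. ln c + (- 1) * x)) borel exp"
    by (subst distr_distr) auto
  also have "\<dots> = mult_haar"
    by (subst lborel_distr_affine_unit) (auto simp: mult_haar_eq_distr_exp)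
  finally show ?thesis .
qed

text \<open>A dilation is the composite of the two inversions \<open>1 / t\<close> and
  \<open>c / t\<close>.\<close>

lemma distr_mult_haar_scale:
  assumes "0 < c"
  shows "distr mult_haar mult_haar (\<lambda>t. c * t) = mult_haar"
proof -
  have "distr mult_haar mult_haar (\<lambda>t. c * t) =
      distr (distr mult_haar mult_haar (\<lambda>t. 1 / t)) mult_haar (\<lambda>t. c / t)"
    by (subst distr_distr) (auto simp: comp_def)
  also have "\<dots> = mult_haar"
    by (simp only: distr_mult_haar_divide assms zero_less_one)
  finally show ?thesis .
qed

text \<open>With \<open>c i = t (i + 1)\<close> this is the invariance behind the change of
  variables. The map acts on each coordinate separately, so preimages of boxes are boxes, and these
  determine the product measure.\<close>

lemma distr_mult_haar_on_divide:
  assumes I: "finite I" and c: "\<And>i. i \<in> I \<Longrightarrow> 0 < c i"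
  shows "distr (mult_haar_on I) (mult_haar_on I) (\<lambda>x. \<lambda>i\<in>I. c i / x i) = mult_haar_on I"
proof (rule mult_haar_prod.PiM_eqI[OF I])
  fix A assume A: "\<And>i. i \<in> I \<Longrightarrow> A i \<in> sets mult_haar"
  let ?T = "\<lambda>x::nat \<Rightarrow> real. \<lambda>i\<in>I. c i / x i"
  have [measurable]: "?T \<in> mult_haar_on I \<rightarrow>\<^sub>M mult_haar_on I"
    by (rule measurable_restrict) simp
  have pre: "(\<lambda>t. c i / t) -` A i \<in> sets mult_haar" if "i \<in> I" for i
    using measurable_sets[of "\<lambda>t. c i / t" mult_haar mult_haar "A i"] A[OF that] by simp
  have "emeasure (distr (mult_haar_on I) (mult_haar_on I) ?T) (Pi\<^sub>E I A) =
      emeasure (mult_haar_on I) (?T -` Pi\<^sub>E I A \<inter> space (mult_haar_on I))"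
    using A I by (intro emeasure_distr) (auto intro!: sets_PiM_I_finite)
  also have "?T -` Pi\<^sub>E I A \<inter> space (mult_haar_on I) = (\<Pi>\<^sub>E i\<in>I. (\<lambda>t. c i / t) -` A i)"
    by (auto simp: space_PiM PiE_iff)
  also have "emeasure (mult_haar_on I) \<dots> = (\<Prod>i\<in>I. emeasure mult_haar ((\<lambda>t. c i / t) -` A i))"
    by (rule mult_haar_prod.emeasure_PiM[OF I pre])
  also have "\<dots> = (\<Prod>i\<in>I. emeasure mult_haar (A i))"
  proof (rule prod.cong)
    fix i assume i: "i \<in> I"
    show "emeasure mult_haar ((\<lambda>t. c i / t) -` A i) = emeasure mult_haar (A i)"
      using emeasure_distr[of "\<lambda>t. c i / t" mult_haar mult_haar "A i"] A[OF i]
        distr_mult_haar_divide[OF c[OF i]]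
      by simp
  qed simp
  finally show "emeasure (distr (mult_haar_on I) (mult_haar_on I) ?T) (Pi\<^sub>E I A) =
      (\<Prod>i\<in>I. emeasure mult_haar (A i))" .
qed simp

text \<open>Against dt/t this function becomes \<open>1 / (1 + t\<^sup>2)\<close>, whose
  antiderivative is arctan. Multiples and products of it serve as the integrable majorants
  throughout.\<close>

lemma integrable_mult_haar_inverse: "integrable mult_haar (\<lambda>t. 1 / (t + 1 / t))"
proof -
  have "(\<integral>\<^sup>+t. ennreal (1 / (1 + t\<^sup>2)) * indicator {0..} t \<partial>lborel) = ennreal (pi / 2 - arctan 0)"
    by (rule nn_integral_FTC_atLeast)
       (auto intro!: derivative_eq_intros tendsto_arctan_at_top simp: add_nonneg_eq_0_iff field_simps)
  then have fin: "(\<integral>\<^sup>+t. ennreal (1 / (1 + t\<^sup>2)) * indicator {0..} t \<partial>lborel) < \<infinity>"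
    by simp
  have *: "indicator {0<..} t / t * (1 / (t + 1 / t)) = 1 / (1 + t\<^sup>2) * indicator {0<..} t" for t :: real
    by (auto simp: indicator_def divide_simps power2_eq_square)
  have "integrable lborel (\<lambda>t. (indicator {0<..} t / t) *\<^sub>R (1 / (t + 1 / t)) :: real)"
  proof (rule integrableI_bounded)
    have "(\<integral>\<^sup>+t. ennreal (norm ((indicator {0<..} t / t) *\<^sub>R (1 / (t + 1 / t)))) \<partial>lborel)
        \<le> (\<integral>\<^sup>+t. ennreal (1 / (1 + t\<^sup>2)) * indicator {0..} t \<partial>lborel)"
      unfolding real_scaleR_def * by (intro nn_integral_mono) (auto simp: indicator_def)
    then show "(\<integral>\<^sup>+t. ennreal (norm ((indicator {0<..} t / t) *\<^sub>R (1 / (t + 1 / t)))) \<partial>lborel) < \<infinity>"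
      using fin by (rule order.strict_trans1)
  qed measurable
  then show ?thesis
    unfolding mult_haar_def by (subst integrable_density) (auto simp: indicator_def)
qed

subsection \<open>Bessel functions\<close>

text \<open>The principal branch jumps across the negative axis, so continuity does not settle the
  matter; on each of the three ranges of the base the power is an explicit measurable
  expression.\<close>

lemma borel_measurable_powr_of_real [measurable (raw)]:
  fixes f :: "'a \<Rightarrow> real" and r :: complex
  assumes [measurable]: "f \<in> borel_measurable M"
  shows "(\<lambda>x. complex_of_real (f x) powr r) \<in> borel_measurable M"
proof -
  have "complex_of_real a powr r = (if a = 0 then 0 else if 0 < a then exp (r * of_real (ln a))
      else exp (r * (of_real (ln (- a)) + \<i> * of_real pi)))" for a
    using Ln_of_real[of a] Ln_minus[of "complex_of_real (- a)"] Ln_of_real[of "- a"]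
    by (auto simp: powr_def algebra_simps)
  then show ?thesis by simp
qed

lemma powr_of_real_mult:
  fixes r :: complex
  assumes "0 < a" "0 < b"
  shows "of_real (a * b) powr r = of_real a powr r * of_real b powr r"
  using assms by (simp add: powr_times_real)

lemma prod_powr_of_real:
  fixes r :: complex
  assumes "\<And>i. i \<in> I \<Longrightarrow> (0::real) < a i"
  shows "(\<Prod>i\<in>I. of_real (a i) powr r) = of_real (\<Prod>i\<in>I. a i) powr r"
  using assms
proof (induction I rule: infinite_finite_induct)
  case (insert i I)
  have "0 < prod a I" using insert by (auto intro: prod_pos)
  with insert show ?case
    by (simp add: powr_of_real_mult del: of_real_mult of_real_prod)
qed auto

lemma powr_of_real_double:
  fixes r :: complex
  assumes "0 < a"
  shows "of_real a powr (2 * r) = of_real (a\<^sup>2) powr r"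
  using assms by (simp add: powr_def Ln_of_real ln_realpow algebra_simps flip: of_real_power)

text \<open>The single term \<open>w ^ N / fact N\<close> of the exponential series is at most its
  sum.\<close>

lemma exp_minus_le_fact_divide_power:
  fixes w :: real
  assumes "0 < w"
  shows "exp (- w) \<le> fact N / w ^ N"
proof -
  have "w ^ N / fact N \<le> exp w"
    using sum_le_suminf[OF summable_exp[of w], of "{N}"] assms
    by (simp add: exp_def divide_inverse mult.commute)
  then show ?thesis
    using assms by (simp add: exp_minus field_simps)
qed

text \<open>Two separate coefficients, because the substitution produces unequal ones;
  \<open>a = b = x / 2\<close> gives back the integrand of \<open>bessel_K\<close>.\<close>

definition bessel_kernel :: "real \<Rightarrow> real \<Rightarrow> complex \<Rightarrow> real \<Rightarrow> complex" where
  "bessel_kernel a b r t = of_real (exp (- a * t - b / t)) * of_real t powr r"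

lemma bessel_kernel_measurable [measurable]: "bessel_kernel a b r \<in> borel_measurable borel"
  unfolding bessel_kernel_def by measurable

lemma norm_bessel_kernel:
  "0 < t \<Longrightarrow> norm (bessel_kernel a b r t) = exp (- a * t - b / t) * t powr Re r"
  by (simp add: bessel_kernel_def norm_mult norm_powr_real_powr)

text \<open>Whichever of \<open>t\<close> and \<open>1 / t\<close> is at least 1 dominates the
  power, and both are at most \<open>t + 1 / t\<close>.\<close>

lemma powr_le_power_add_inverse:
  fixes t :: real
  assumes t: "0 < t" and p: "\<bar>e\<bar> \<le> real p"
  shows "t powr e \<le> (t + 1 / t) ^ p"
proof (cases "1 \<le> t")
  case True
  have "t powr e \<le> t powr real p" using True p by (intro powr_mono) auto
  also have "\<dots> = t ^ p" using t by (simp add: powr_realpow)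
  also have "\<dots> \<le> (t + 1 / t) ^ p" using t by (intro power_mono) auto
  finally show ?thesis .
next
  case False
  have "t powr e = (1 / t) powr (- e)" using t by (simp add: powr_minus powr_divide divide_simps)
  also have "\<dots> \<le> (1 / t) powr real p" using False t p by (intro powr_mono) auto
  also have "\<dots> = (1 / t) ^ p" using t by (subst powr_realpow) auto
  also have "\<dots> \<le> (t + 1 / t) ^ p" using t by (intro power_mono) auto
  finally show ?thesis .
qed

text \<open>With \<open>h = t + 1 / t\<close> the exponential is at most
  \<open>fact N / (a * h) ^ N\<close>, while the power of \<open>t\<close> costs at most
  \<open>h ^ (N - 1)\<close>. The surviving factor \<open>1 / h\<close> is integrable.\<close>

lemma norm_bessel_kernel_le:
  assumes a: "0 < a" and N: "\<bar>Re r\<bar> + 1 \<le> real N" and t: "0 < t"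
  shows "norm (bessel_kernel a a r t) \<le> fact N / a ^ N * (1 / (t + 1 / t))"
proof -
  from N obtain p where p: "N = Suc p" by (cases N) auto
  define h where "h = t + 1 / t"
  have h: "0 < h" using t by (simp add: h_def add_pos_pos)
  have "norm (bessel_kernel a a r t) = exp (- (a * h)) * t powr Re r"
    using t by (simp add: norm_bessel_kernel h_def algebra_simps)
  also have "\<dots> \<le> (fact N / (a * h) ^ N) * h ^ p"
    using a h t p N exp_minus_le_fact_divide_power[of "a * h" N]
    by (intro mult_mono) (auto simp: h_def intro!: powr_le_power_add_inverse)
  also have "\<dots> = fact N / a ^ N * (1 / h)"
    using h p a by (simp add: power_mult_distrib field_simps)
  finally show ?thesis unfolding h_def .
qed

lemma integrable_bessel_kernel_diag:
  assumes "0 < a"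
  shows "integrable mult_haar (bessel_kernel a a r)"
proof -
  obtain N :: nat where N: "\<bar>Re r\<bar> + 1 \<le> real N"
    using real_arch_simple by blast
  have "integrable mult_haar (\<lambda>t. fact N / a ^ N * (1 / (t + 1 / t)))"
    by (intro integrable_mult_right integrable_mult_haar_inverse)
  then show ?thesis
  proof (rule Bochner_Integration.integrable_bound)
    show "AE t in mult_haar. norm (bessel_kernel a a r t) \<le> norm (fact N / a ^ N * (1 / (t + 1 / t)))"
      using AE_mult_haar_pos
    proof eventually_elim
      case (elim t)
      then show ?case
        using norm_bessel_kernel_le[OF assms N elim] unfolding real_norm_def by linarith
    qed
  qed simp
qed

lemma bessel_K_eq_bessel_kernel:
  "bessel_K r x = 1 / 2 * (\<integral>t. bessel_kernel (x / 2) (x / 2) r t \<partial>mult_haar)"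
proof -
  have "- (x / 2) * (t + 1 / t) = - (x / 2) * t - x / 2 / t" for t
    by (simp add: algebra_simps)
  then show ?thesis by (simp only: bessel_K_def bessel_kernel_def)
qed

text \<open>Integrating the previous pointwise bound with \<open>a = x / 2\<close> gives one
  estimate for both ends: a crude bound on the singularity at 0, and decay at infinity of any
  prescribed order.\<close>

lemma norm_bessel_K_le:
  assumes N: "\<bar>Re r\<bar> + 1 \<le> real N"
  shows "\<exists>C\<ge>0. \<forall>x>0. norm (bessel_K r x) \<le> C / x ^ N"
proof (intro exI[of _ "fact N * 2 ^ N * (\<integral>t. 1 / (t + 1 / t) \<partial>mult_haar)"] conjI allI impI)
  let ?c = "\<integral>t. 1 / (t + 1 / t) \<partial>mult_haar"
  have "0 \<le> ?c"
    using AE_mult_haar_pos by (intro integral_nonneg_AE) (auto elim!: eventually_mono)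
  then show "0 \<le> fact N * 2 ^ N * ?c" by simp
  fix x :: real assume x: "0 < x"
  have int: "integrable mult_haar (\<lambda>t. fact N / (x / 2) ^ N * (1 / (t + 1 / t)))"
    by (intro integrable_mult_right integrable_mult_haar_inverse)
  have bound: "norm (bessel_kernel (x / 2) (x / 2) r t) \<le> fact N / (x / 2) ^ N * (1 / (t + 1 / t))"
    if "0 < t" for t
    using x that by (intro norm_bessel_kernel_le[OF _ N]) auto
  have "norm (\<integral>t. bessel_kernel (x / 2) (x / 2) r t \<partial>mult_haar)
      \<le> (\<integral>t. norm (bessel_kernel (x / 2) (x / 2) r t) \<partial>mult_haar)"
    by (rule integral_norm_bound)
  also have "\<dots> \<le> (\<integral>t. fact N / (x / 2) ^ N * (1 / (t + 1 / t)) \<partial>mult_haar)"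
    using x eventually_mono[OF AE_mult_haar_pos bound]
    by (intro integral_mono_AE integrable_norm integrable_bessel_kernel_diag int) auto
  also have "\<dots> = fact N / (x / 2) ^ N * ?c"
    by (rule integral_mult_right_zero)
  finally have *: "norm (\<integral>t. bessel_kernel (x / 2) (x / 2) r t \<partial>mult_haar) \<le>
      fact N * 2 ^ N * ?c / x ^ N"
    by (simp add: power_divide field_simps)
  have "norm (bessel_K r x) \<le> norm (\<integral>t. bessel_kernel (x / 2) (x / 2) r t \<partial>mult_haar)"
    unfolding bessel_K_eq_bessel_kernel by (simp add: norm_mult)
  with * show "norm (bessel_K r x) \<le> fact N * 2 ^ N * ?c / x ^ N"
    by linarith
qed

text \<open>The dilation by \<open>sqrt (b / a)\<close> makes both coefficients equal to their
  geometric mean.\<close>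

lemma bessel_kernel_scale:
  assumes "0 < a" "0 < b" "0 < t"
  shows "bessel_kernel a b r (sqrt (b / a) * t) =
    of_real (sqrt (b / a)) powr r * bessel_kernel (sqrt (a * b)) (sqrt (a * b)) r t"
proof -
  have "a * (sqrt (b / a) * t) = sqrt (a * b) * t"
    using assms by (simp add: real_sqrt_mult real_sqrt_divide field_simps)
  moreover have "b / (sqrt (b / a) * t) = sqrt (a * b) / t"
    using assms by (simp add: real_sqrt_mult real_sqrt_divide field_simps)
  ultimately show ?thesis
    using assms unfolding bessel_kernel_def
    by (simp add: powr_times_real)
qed

lemma integrable_bessel_kernel:
  assumes "0 < a" "0 < b"
  shows "integrable mult_haar (bessel_kernel a b r)"
proof -
  let ?c = "sqrt (b / a)"
  have c: "0 < ?c" using assms by simp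
  have "integrable mult_haar (\<lambda>t. of_real ?c powr r *
      bessel_kernel (sqrt (a * b)) (sqrt (a * b)) r t)"
    using assms by (intro integrable_mult_right integrable_bessel_kernel_diag) simp
  then have "integrable mult_haar (\<lambda>t. bessel_kernel a b r (?c * t))"
    by (rule integrable_cong_AE_imp)
       (use AE_mult_haar_pos in \<open>auto elim!: eventually_mono simp: bessel_kernel_scale[OF assms]\<close>)
  then have "integrable (distr mult_haar mult_haar ((*) ?c)) (bessel_kernel a b r)"
    by (subst integrable_distr_eq) auto
  then show ?thesis
    by (simp only: distr_mult_haar_scale[OF c])
qed

text \<open>The order is written \<open>2 * s\<close> so that the dilation factor
  \<open>sqrt (b / a)\<close>, raised to it, becomes an \<open>s\<close>-th power of
  \<open>b / a\<close>.\<close>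

lemma integral_bessel_kernel:
  assumes "0 < a" "0 < b"
  shows "(\<integral>t. bessel_kernel a b (2 * s) t \<partial>mult_haar) =
    of_real (b / a) powr s * (2 * bessel_K (2 * s) (2 * sqrt (a * b)))"
proof -
  let ?c = "sqrt (b / a)"
  have c: "0 < ?c" using assms by simp
  have "(\<integral>t. bessel_kernel a b (2 * s) t \<partial>mult_haar) =
      (\<integral>t. bessel_kernel a b (2 * s) t \<partial>distr mult_haar mult_haar ((*) ?c))"
    by (simp only: distr_mult_haar_scale[OF c])
  also have "\<dots> = (\<integral>t. bessel_kernel a b (2 * s) (?c * t) \<partial>mult_haar)"
    by (rule integral_distr) auto
  also have "\<dots> = (\<integral>t. of_real ?c powr (2 * s) *
      bessel_kernel (sqrt (a * b)) (sqrt (a * b)) (2 * s) t \<partial>mult_haar)"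
    using AE_mult_haar_pos
    by (intro integral_cong_AE) (auto elim!: eventually_mono simp: bessel_kernel_scale[OF assms])
  also have "\<dots> = of_real ?c powr (2 * s) * (2 * bessel_K (2 * s) (2 * sqrt (a * b)))"
    by (simp add: bessel_K_eq_bessel_kernel)
  also have "of_real ?c powr (2 * s) = of_real (b / a) powr s"
    using powr_of_real_double[OF c] assms by simp
  finally show ?thesis .
qed

text \<open>For positive \<open>t\<close> the absolute value of \<open>t powr r\<close> depends only
  on \<open>Re r\<close>. Integrals of absolute values are therefore again Bessel integrals, of real
  order, and can be evaluated in closed form.\<close>

lemma integral_norm_bessel_kernel:
  "(\<integral>t. norm (bessel_kernel a b r t) \<partial>mult_haar) =
    norm (\<integral>t. bessel_kernel a b (of_real (Re r)) t \<partial>mult_haar)"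
proof -
  have "(\<integral>t. bessel_kernel a b (of_real (Re r)) t \<partial>mult_haar) =
      (\<integral>t. of_real (norm (bessel_kernel a b r t)) \<partial>mult_haar)"
    using AE_mult_haar_pos
    by (intro integral_cong_AE)
       (auto elim!: eventually_mono simp: norm_mult norm_powr_real_powr bessel_kernel_def powr_of_real)
  also have "\<dots> = of_real (\<integral>t. norm (bessel_kernel a b r t) \<partial>mult_haar)"
    by (rule integral_complex_of_real)
  finally show ?thesis
    by (simp add: integral_nonneg_AE)
qed

lemma bessel_K_measurable [measurable]: "bessel_K r \<in> borel_measurable borel"
  unfolding bessel_K_def by measurable

subsection \<open>Telescoping products\<close>

text \<open>After the substitution, \<open>coeff_a\<close> and \<open>coeff_b\<close> multiply
  \<open>- t i\<close> and \<open>- 1 / t i\<close> in the exponent. The conditionals encode the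
  conventions \<open>1 / v n = 0\<close> here and \<open>v 0 = 0\<close> in
  \<open>coeff_b\<close>.\<close>

definition coeff_a :: "nat \<Rightarrow> (nat \<Rightarrow> real) \<Rightarrow> (nat \<Rightarrow> real) \<Rightarrow> nat \<Rightarrow> real" where
  "coeff_a n y v i = (pi * y i)\<^sup>2 * (1 + (if i = n then 0 else 1 / v i))"

definition coeff_b :: "(nat \<Rightarrow> real) \<Rightarrow> nat \<Rightarrow> real" where
  "coeff_b v i = 1 + (if i = 1 then 0 else v (i - 1))"

text \<open>For positive \<open>y i\<close> this is
  \<open>2 * sqrt (coeff_a n y v i * coeff_b v i)\<close>. Like \<open>lower_args\<close>, it is
  spelled as in the theorem, so that unfolding alone closes the final step.\<close>

definition bessel_arg :: "nat \<Rightarrow> (nat \<Rightarrow> real) \<Rightarrow> (nat \<Rightarrow> real) \<Rightarrow> nat \<Rightarrow> real" where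
  "bessel_arg n y v i = 2 * pi * y i *
     sqrt ((1 + (if i = 1 then 0 else v (i - 1))) * (1 + (if i = n then 0 else 1 / v i)))"

definition lower_args :: "nat \<Rightarrow> (nat \<Rightarrow> real) \<Rightarrow> (nat \<Rightarrow> real) \<Rightarrow> nat \<Rightarrow> real" where
  "lower_args n y v i =
     (if i \<le> n - 2 then y (i + 1) * sqrt (v i / v (i + 1)) else y n * sqrt (v (n - 1)))"

text \<open>What remains of the complex powers once those of \<open>t\<close> are moved into the
  kernels: \<open>t (i + 1) * u i\<close> turns into
  \<open>(t (i + 1))\<^sup>2 / v i\<close>.\<close>

definition power_factor :: "nat \<Rightarrow> complex \<Rightarrow> (nat \<Rightarrow> real) \<Rightarrow> (nat \<Rightarrow> real) \<Rightarrow> complex" where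
  "power_factor n s y v =
     (\<Prod>i=1..n. of_real (pi * y i) powr (2 * s)) * (\<Prod>i=1..n-1. of_real (1 / v i) powr s)"

text \<open>Padding with a trivial factor turns a product over the \<open>n - 1\<close> inner
  variables into one over \<open>n\<close> indices, which can be merged factor by factor with the
  product over \<open>t\<close>. \<open>prod_if_first\<close> does the same with a shift.\<close>

lemma prod_if_last:
  fixes g :: "nat \<Rightarrow> 'a::comm_monoid_mult"
  assumes "1 \<le> n"
  shows "(\<Prod>i=1..n. if i = n then 1 else g i) = (\<Prod>i=1..n-1. g i)"
proof -
  from assms obtain m where n: "n = Suc m" by (cases n) auto
  have "(\<Prod>i=1..m. if i = n then 1 else g i) = (\<Prod>i=1..m. g i)"
    by (rule prod.cong) (auto simp: n)
  then show ?thesis by (simp add: n)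
qed

lemma prod_if_first:
  fixes g :: "nat \<Rightarrow> 'a::comm_monoid_mult"
  assumes "1 \<le> n"
  shows "(\<Prod>i=1..n. if i = 1 then 1 else g i) = (\<Prod>i=1..n-1. g (i + 1))"
proof -
  from assms obtain m where n: "n = Suc m" by (cases n) auto
  have "(\<Prod>i=1..n. if i = 1 then 1 else g i) = (\<Prod>i=Suc 1..Suc m. if i = 1 then 1 else g i)"
    by (simp add: n prod.atLeast_Suc_atMost)
  also have "\<dots> = (\<Prod>i=1..m. g (i + 1))"
    by (subst prod.shift_bounds_cl_Suc_ivl) (auto intro!: prod.cong)
  finally show ?thesis by (simp add: n)
qed

lemma coeff_b_pos:
  assumes v: "\<And>i. i \<in> {1..n-1} \<Longrightarrow> 0 < v i" and "i \<in> {1..n}"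
  shows "0 < coeff_b v i"
proof (cases "i = 1")
  case False
  with assms(2) have "i - 1 \<in> {1..n-1}" by auto
  from v[OF this] show ?thesis using False by (simp add: coeff_b_def)
qed (simp add: coeff_b_def)

lemma coeff_c_pos:
  fixes v :: "nat \<Rightarrow> real"
  assumes v: "\<And>i. i \<in> {1..n-1} \<Longrightarrow> 0 < v i" and "i \<in> {1..n}"
  shows "0 < 1 + (if i = n then 0 else 1 / v i)"
  using v[of i] assms(2) by (cases "i = n") (auto intro!: add_pos_pos)

lemma prod_coeff_b:
  assumes n: "1 \<le> n"
  shows "(\<Prod>i=1..n. coeff_b v i) = (\<Prod>i=1..n-1. 1 + v i)"
proof -
  have "(\<Prod>i=1..n. coeff_b v i) = (\<Prod>i=1..n. if i = 1 then 1 else 1 + v (i - 1))"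
    by (rule prod.cong) (auto simp: coeff_b_def)
  then show ?thesis using prod_if_first[OF n, of "\<lambda>i. 1 + v (i - 1)"] by simp
qed

lemma prod_coeff_c:
  fixes v :: "nat \<Rightarrow> real"
  assumes n: "1 \<le> n"
  shows "(\<Prod>i=1..n. 1 + (if i = n then 0 else 1 / v i)) = (\<Prod>i=1..n-1. 1 + 1 / v i)"
proof -
  have "(\<Prod>i=1..n. 1 + (if i = n then 0 else 1 / v i)) = (\<Prod>i=1..n. if i = n then 1 else 1 + 1 / v i)"
    by (rule prod.cong) auto
  then show ?thesis using prod_if_last[OF n, of "\<lambda>i. 1 + 1 / v i"] by simp
qed

context
  fixes n :: nat and y v :: "nat \<Rightarrow> real"
  assumes n: "1 \<le> n"
    and y: "\<And>i. i \<in> {1..n} \<Longrightarrow> 0 < y i"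
    and v: "\<And>i. i \<in> {1..n-1} \<Longrightarrow> 0 < v i"
begin

lemma coeff_a_pos: "i \<in> {1..n} \<Longrightarrow> 0 < coeff_a n y v i"
  using y[of i] coeff_c_pos[of n v i, OF v] unfolding coeff_a_def by (intro mult_pos_pos) auto

text \<open>The squares cancel inside \<open>coeff_a\<close>; regrouped by \<open>v i\<close>, what
  is left is \<open>(1 + v i) / (1 + 1 / v i) = v i\<close>.\<close>

lemma prod_coeff_ratio:
  "(\<Prod>i=1..n. coeff_b v i / coeff_a n y v i) * (\<Prod>i=1..n. (pi * y i)\<^sup>2) * (\<Prod>i=1..n-1. 1 / v i) = 1"
proof -
  have "(\<Prod>i=1..n. coeff_b v i / coeff_a n y v i) * (\<Prod>i=1..n. (pi * y i)\<^sup>2) =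
      (\<Prod>i=1..n. coeff_b v i / (1 + (if i = n then 0 else 1 / v i)))"
    unfolding prod.distrib[symmetric]
    using y by (intro prod.cong) (auto simp: coeff_a_def less_imp_neq[symmetric])
  also have "\<dots> = (\<Prod>i=1..n-1. 1 + v i) / (\<Prod>i=1..n-1. 1 + 1 / v i)"
    by (simp only: prod_dividef prod_coeff_b[OF n] prod_coeff_c[OF n])
  also have "\<dots> * (\<Prod>i=1..n-1. 1 / v i) = (\<Prod>i=1..n-1. (1 + v i) / (1 + 1 / v i) * (1 / v i))"
    by (simp only: prod_dividef prod.distrib)
  also have "\<dots> = 1"
  proof (rule prod.neutral, rule ballI)
    fix i assume "i \<in> {1..n-1}"
    then have "0 < v i" by (rule v)
    then show "(1 + v i) / (1 + 1 / v i) * (1 / v i) = 1"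
      by (simp add: divide_simps)
  qed
  finally show ?thesis .
qed

text \<open>Each integral contributes \<open>2 * bessel_K\<close> and an \<open>s\<close>-th power
  of \<open>coeff_b / coeff_a\<close>; these powers cancel exactly against
  \<open>power_factor\<close>.\<close>

lemma prod_integral_bessel_kernel:
  "(\<Prod>i=1..n. \<integral>t. bessel_kernel (coeff_a n y v i) (coeff_b v i) (2 * s) t \<partial>mult_haar) *
     power_factor n s y v = 2 ^ n * (\<Prod>i=1..n. bessel_K (2 * s) (bessel_arg n y v i))"
proof -
  let ?a = "coeff_a n y v" and ?b = "coeff_b v"
  have arg: "2 * sqrt (?a i * ?b i) = bessel_arg n y v i" if "i \<in> {1..n}" for i
    using y[OF that] by (simp add: coeff_a_def coeff_b_def bessel_arg_def real_sqrt_mult mult_ac)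
  have "(\<Prod>i=1..n. \<integral>t. bessel_kernel (?a i) (?b i) (2 * s) t \<partial>mult_haar) =
      (\<Prod>i=1..n. of_real (?b i / ?a i) powr s * (2 * bessel_K (2 * s) (bessel_arg n y v i)))"
    by (intro prod.cong refl) (simp only: integral_bessel_kernel coeff_a_pos coeff_b_pos[OF v] arg)
  also have "\<dots> = (\<Prod>i=1..n. of_real (?b i / ?a i) powr s) *
      (2 ^ n * (\<Prod>i=1..n. bessel_K (2 * s) (bessel_arg n y v i)))"
    by (simp add: prod.distrib)
  finally have int: "(\<Prod>i=1..n. \<integral>t. bessel_kernel (?a i) (?b i) (2 * s) t \<partial>mult_haar) = \<dots>" .
  have "(\<Prod>i=1..n. of_real (?b i / ?a i) powr s) * power_factor n s y v =
      (\<Prod>i=1..n. of_real (?b i / ?a i) powr s) * (\<Prod>i=1..n. of_real ((pi * y i)\<^sup>2) powr s) *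
        (\<Prod>i=1..n-1. of_real (1 / v i) powr s)"
    unfolding power_factor_def mult.assoc
    using y by (intro arg_cong2[of _ _ _ _ "(*)"] prod.cong refl powr_of_real_double) auto
  \<comment> \<open>All bases are positive, so principal powers with the common exponent
    \<open>s\<close> merge into one power of the product, which \<open>prod_coeff_ratio\<close>
    evaluates to 1.\<close>
  also have "\<dots> = of_real ((\<Prod>i=1..n. ?b i / ?a i) * (\<Prod>i=1..n. (pi * y i)\<^sup>2) *
      (\<Prod>i=1..n-1. 1 / v i)) powr s"
  proof -
    have "0 < (\<Prod>i=1..n. ?b i / ?a i)" "0 < (\<Prod>i=1..n. (pi * y i)\<^sup>2)" "0 < (\<Prod>i=1..n-1. 1 / v i)"
      using coeff_a_pos coeff_b_pos[OF v] y v by (auto intro!: prod_pos simp: zero_less_power2 less_imp_neq[symmetric])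
    moreover have "(\<Prod>i=1..n. of_real (?b i / ?a i) powr s) = of_real (\<Prod>i=1..n. ?b i / ?a i) powr s"
      using coeff_a_pos coeff_b_pos[OF v] by (intro prod_powr_of_real) auto
    moreover have "(\<Prod>i=1..n. of_real ((pi * y i)\<^sup>2) powr s) = of_real (\<Prod>i=1..n. (pi * y i)\<^sup>2) powr s"
      using y by (intro prod_powr_of_real) (auto simp: zero_less_power2 less_imp_neq[symmetric])
    moreover have "(\<Prod>i=1..n-1. of_real (1 / v i) powr s) = of_real (\<Prod>i=1..n-1. 1 / v i) powr s"
      using v by (intro prod_powr_of_real) auto
    ultimately show ?thesis
      by (simp only: powr_of_real_mult mult_pos_pos)
  qed
  also have "\<dots> = 1"
    by (simp only: prod_coeff_ratio) simp
  finally show ?thesis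
    unfolding int by (simp add: mult_ac)
qed

end

subsection \<open>Decay estimates\<close>

text \<open>A weight for growth at 0 and at infinity at once: symmetric under inversion,
  submultiplicative, and at least 2 on the positive reals.\<close>

definition add_recip :: "real \<Rightarrow> real" where
  "add_recip t = t + 1 / t"

lemma add_recip_ge_2: "0 < t \<Longrightarrow> 2 \<le> add_recip t"
  using sum_squares_ge_zero[of "t - 1" 0]
  by (simp add: add_recip_def field_simps power2_eq_square)

lemma add_recip_pos: "0 < t \<Longrightarrow> 0 < add_recip t"
  using add_recip_ge_2[of t] by simp

lemma add_recip_mult_le: "0 < s \<Longrightarrow> 0 < t \<Longrightarrow> add_recip (s * t) \<le> add_recip s * add_recip t"
  by (simp add: add_recip_def algebra_simps)

lemma add_recip_divide_le: "0 < s \<Longrightarrow> 0 < t \<Longrightarrow> add_recip (s / t) \<le> add_recip s * add_recip t"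
  using add_recip_mult_le[of s "1 / t"] by (simp add: add_recip_def add.commute)

text \<open>With \<open>k = add_recip (sqrt t)\<close> one has
  \<open>add_recip t = k\<^sup>2 - 2\<close>, and
  \<open>k\<^sup>2 - 2 - k = (k - 2) * (k + 1)\<close> is nonnegative because
  \<open>k \<ge> 2\<close>.\<close>

lemma add_recip_sqrt_le:
  assumes "0 < t"
  shows "add_recip (sqrt t) \<le> add_recip t"
proof -
  define k where "k = add_recip (sqrt t)"
  have k: "2 \<le> k" using assms by (simp add: k_def add_recip_ge_2)
  have "add_recip t = k\<^sup>2 - 2"
    using assms by (simp add: k_def add_recip_def power2_sum power_divide)
  moreover have "k\<^sup>2 - 2 - k = (k - 2) * (k + 1)"
    by (simp add: power2_eq_square algebra_simps)
  moreover have "0 \<le> (k - 2) * (k + 1)" using k by simp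
  ultimately show ?thesis unfolding k_def by linarith
qed

lemma prod_add_recip_ge_1:
  "(\<And>i. i \<in> I \<Longrightarrow> 0 < x i) \<Longrightarrow> 1 \<le> (\<Prod>i\<in>I. add_recip (x i))"
  using add_recip_ge_2 by (intro prod_ge_1) fastforce

lemma add_recip_le_prod:
  assumes "finite I" "j \<in> I" "\<And>i. i \<in> I \<Longrightarrow> 0 < x i"
  shows "add_recip (x j) \<le> (\<Prod>i\<in>I. add_recip (x i))"
proof -
  have "1 \<le> (\<Prod>i\<in>I - {j}. add_recip (x i))"
    using assms by (intro prod_add_recip_ge_1) auto
  then have "add_recip (x j) * 1 \<le> add_recip (x j) * (\<Prod>i\<in>I - {j}. add_recip (x i))"
    using add_recip_pos[of "x j"] assms by (intro mult_left_mono) auto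
  then show ?thesis using assms by (simp add: prod.remove[of I j])
qed

lemma lower_args_pos:
  assumes "2 \<le> n" "\<And>i. i \<in> {1..n} \<Longrightarrow> 0 < y i" "\<And>i. i \<in> {1..n-1} \<Longrightarrow> 0 < v i" "i \<in> {1..n-1}"
  shows "0 < lower_args n y v i"
  using assms(1) assms(2)[of "i + 1"] assms(2)[of n] assms(3)[of i] assms(3)[of "i + 1"]
    assms(3)[of "n - 1"] assms(4)
  by (auto simp: lower_args_def)

text \<open>Submultiplicativity splits each argument into one \<open>y\<close> and at most two
  \<open>v\<close>. The bound is the same for all \<open>i\<close>, so the product over
  \<open>i\<close> is bounded by a plain power.\<close>

lemma add_recip_lower_args_le:
  assumes n: "2 \<le> n" and y: "\<And>i. i \<in> {1..n} \<Longrightarrow> 0 < y i" and v: "\<And>i. i \<in> {1..n-1} \<Longrightarrow> 0 < v i"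
    and i: "i \<in> {1..n-1}"
  shows "add_recip (lower_args n y v i) \<le>
    (\<Prod>i=1..n. add_recip (y i)) * (\<Prod>i=1..n-1. add_recip (v i))\<^sup>2"
proof -
  let ?Y = "\<Prod>i=1..n. add_recip (y i)" and ?V = "\<Prod>i=1..n-1. add_recip (v i)"
  have Y: "add_recip (y j) \<le> ?Y" if "j \<in> {1..n}" for j
    using that y by (intro add_recip_le_prod) auto
  have V: "add_recip (v j) \<le> ?V" if "j \<in> {1..n-1}" for j
    using that v by (intro add_recip_le_prod) auto
  have Y1: "1 \<le> ?Y" and V1: "1 \<le> ?V"
    using y v by (auto intro!: prod_add_recip_ge_1)
  show ?thesis
  proof (cases "i \<le> n - 2")
    case True
    with i n have j: "i + 1 \<in> {1..n}" "i + 1 \<in> {1..n-1}" by auto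
    have "add_recip (lower_args n y v i) \<le> add_recip (y (i + 1)) * add_recip (sqrt (v i / v (i + 1)))"
      using True y[OF j(1)] v[OF i] v[OF j(2)]
      by (auto simp: lower_args_def intro!: add_recip_mult_le)
    also have "add_recip (sqrt (v i / v (i + 1))) \<le> add_recip (v i / v (i + 1))"
      using v[OF i] v[OF j(2)] by (intro add_recip_sqrt_le) auto
    also have "\<dots> \<le> add_recip (v i) * add_recip (v (i + 1))"
      using v[OF i] v[OF j(2)] by (intro add_recip_divide_le) auto
    also have "\<dots> \<le> ?V * ?V"
      using V[OF i] V[OF j(2)] V1 add_recip_pos[OF v[OF j(2)]]
      by (intro mult_mono) auto
    finally have "add_recip (lower_args n y v i) \<le> add_recip (y (i + 1)) * (?V * ?V)"
      using add_recip_pos[OF y[OF j(1)]] by (simp add: mult_left_mono)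
    also have "\<dots> \<le> ?Y * (?V * ?V)"
      using Y[OF j(1)] by (intro mult_right_mono) auto
    finally show ?thesis by (simp add: power2_eq_square)
  next
    case False
    from i n have j: "n \<in> {1..n}" "n - 1 \<in> {1..n-1}" by auto
    have "add_recip (lower_args n y v i) \<le> add_recip (y n) * add_recip (sqrt (v (n - 1)))"
      using False y[OF j(1)] v[OF j(2)]
      by (auto simp: lower_args_def intro!: add_recip_mult_le)
    also have "\<dots> \<le> ?Y * ?V\<^sup>2"
    proof (rule mult_mono)
      have "add_recip (sqrt (v (n - 1))) \<le> ?V"
        using add_recip_sqrt_le[OF v[OF j(2)]] V[OF j(2)] by simp
      \<comment> \<open>The last argument involves a single \<open>v\<close>;
        \<open>1 \<le> ?V\<close> pads the bound to the common exponent.\<close>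
      also have "?V \<le> ?V\<^sup>2" using V1 by (simp add: power2_eq_square)
      finally show "add_recip (sqrt (v (n - 1))) \<le> ?V\<^sup>2" .
    qed (use Y[OF j(1)] Y1 v[OF j(2)] in \<open>auto intro!: less_imp_le[OF add_recip_pos]\<close>)
    finally show ?thesis .
  qed
qed

text \<open>Each \<open>v i\<close> occurs in two neighbouring Bessel arguments, as
  \<open>1 + 1 / v i\<close> and as \<open>1 + v i\<close>. Grouped by \<open>v i\<close>, the pair
  dominates \<open>add_recip (v i)\<close>, giving decay in every variable at both ends.\<close>

lemma prod_bessel_arg_factors_ge:
  fixes v :: "nat \<Rightarrow> real"
  assumes n: "1 \<le> n" and v: "\<And>i. i \<in> {1..n-1} \<Longrightarrow> 0 < v i"
  shows "(\<Prod>i=1..n-1. add_recip (v i)) \<le>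
    (\<Prod>i=1..n. (1 + (if i = 1 then 0 else v (i - 1))) * (1 + (if i = n then 0 else 1 / v i)))"
proof -
  have "(\<Prod>i=1..n-1. add_recip (v i)) \<le> (\<Prod>i=1..n-1. (1 + v i) * (1 + 1 / v i))"
  proof (rule prod_mono)
    fix i assume "i \<in> {1..n-1}"
    then have "0 < v i" by (rule v)
    then show "0 \<le> add_recip (v i) \<and> add_recip (v i) \<le> (1 + v i) * (1 + 1 / v i)"
      by (simp add: add_recip_def add_divide_distrib algebra_simps)
  qed
  also have "\<dots> = (\<Prod>i=1..n. coeff_b v i) * (\<Prod>i=1..n. 1 + (if i = n then 0 else 1 / v i))"
    unfolding prod_coeff_b[OF n] prod_coeff_c[OF n] by (rule prod.distrib)
  finally show ?thesis by (simp only: coeff_b_def prod.distrib)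
qed

text \<open>The even exponent \<open>2 * M\<close> removes the square roots in the Bessel arguments.
  The constant is uniform in \<open>y\<close> and \<open>v\<close>.\<close>

lemma prod_bessel_K_le:
  assumes n: "1 \<le> n" and M: "\<bar>Re r\<bar> + 1 \<le> real (2 * M)"
  shows "\<exists>C\<ge>0. \<forall>y v. (\<forall>i\<in>{1..n}. 0 < y i) \<longrightarrow> (\<forall>i\<in>{1..n-1}. 0 < v i) \<longrightarrow>
    norm (\<Prod>i=1..n. bessel_K r (bessel_arg n y v i)) \<le>
      C * (\<Prod>i=1..n. add_recip (y i)) ^ (2 * M) / (\<Prod>i=1..n-1. add_recip (v i)) ^ M"
proof -
  obtain C where C: "0 \<le> C" "\<And>x. 0 < x \<Longrightarrow> norm (bessel_K r x) \<le> C / x ^ (2 * M)"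
    using norm_bessel_K_le[OF M] by blast
  show ?thesis
  proof (intro exI[of _ "C ^ n"] conjI allI impI)
    show "0 \<le> C ^ n" using C(1) by simp
    fix y v :: "nat \<Rightarrow> real"
    assume y: "\<forall>i\<in>{1..n}. 0 < y i" and v: "\<forall>i\<in>{1..n-1}. 0 < v i"
    define q where "q i = (1 + (if i = 1 then 0 else v (i - 1))) * (1 + (if i = n then 0 else 1 / v i))" for i
    have q: "0 < q i" if "i \<in> {1..n}" for i
      unfolding q_def coeff_b_def[symmetric]
      using that v by (intro mult_pos_pos coeff_b_pos[of n] coeff_c_pos) auto
    have factor: "norm (bessel_K r (bessel_arg n y v i)) \<le> C * (add_recip (y i) ^ (2 * M) / q i ^ M)"
      if i: "i \<in> {1..n}" for i
    proof -
      have yi: "0 < y i" using y i by auto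
      have arg: "bessel_arg n y v i = 2 * pi * y i * sqrt (q i)"
        by (simp add: bessel_arg_def q_def)
      have "norm (bessel_K r (bessel_arg n y v i)) \<le> C / (2 * pi * y i * sqrt (q i)) ^ (2 * M)"
        unfolding arg using yi q[OF i] by (intro C) simp
      also have "(2 * pi * y i * sqrt (q i)) ^ (2 * M) = (2 * pi * y i) ^ (2 * M) * q i ^ M"
        using q[OF i] by (simp add: power_mult_distrib power_mult)
      also have "C / \<dots> = C * ((1 / (2 * pi * y i)) ^ (2 * M) / q i ^ M)"
        by (simp add: power_divide)
      also have "\<dots> \<le> C * (add_recip (y i) ^ (2 * M) / q i ^ M)"
      proof (intro mult_left_mono divide_right_mono power_mono)
        have "1 / (2 * pi * y i) \<le> 1 / y i"
          using yi pi_ge_two by (intro divide_left_mono) auto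
        then show "1 / (2 * pi * y i) \<le> add_recip (y i)"
          using yi by (simp add: add_recip_def)
      qed (use yi q[OF i] C in auto)
      finally show ?thesis .
    qed
    have "norm (\<Prod>i=1..n. bessel_K r (bessel_arg n y v i)) \<le>
        (\<Prod>i=1..n. C * (add_recip (y i) ^ (2 * M) / q i ^ M))"
      unfolding prod_norm[symmetric] using factor by (intro prod_mono) auto
    also have "\<dots> = C ^ n * (\<Prod>i=1..n. add_recip (y i)) ^ (2 * M) / (\<Prod>i=1..n. q i) ^ M"
      by (simp add: prod.distrib prod_dividef prod_power_distrib)
    also have "\<dots> \<le> C ^ n * (\<Prod>i=1..n. add_recip (y i)) ^ (2 * M) / (\<Prod>i=1..n-1. add_recip (v i)) ^ M"
    proof (intro divide_left_mono power_mono)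
      show "(\<Prod>i=1..n-1. add_recip (v i)) \<le> (\<Prod>i=1..n. q i)"
        unfolding q_def using v by (intro prod_bessel_arg_factors_ge[OF n]) auto
      have "0 < (\<Prod>i=1..n-1. add_recip (v i))"
        using v by (auto intro!: prod_pos add_recip_pos)
      moreover have "0 < (\<Prod>i=1..n. q i)" using q by (auto intro!: prod_pos)
      ultimately show "0 \<le> (\<Prod>i=1..n-1. add_recip (v i))"
        "0 < (\<Prod>i=1..n. q i) ^ M * (\<Prod>i=1..n-1. add_recip (v i)) ^ M"
        by simp_all
      show "0 \<le> C ^ n * (\<Prod>i=1..n. add_recip (y i)) ^ (2 * M)" using C by simp
    qed
    finally show "norm (\<Prod>i=1..n. bessel_K r (bessel_arg n y v i)) \<le>
      C ^ n * (\<Prod>i=1..n. add_recip (y i)) ^ (2 * M) / (\<Prod>i=1..n-1. add_recip (v i)) ^ M" .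
  qed
qed

subsection \<open>The change of variables\<close>

text \<open>The induction invariant for the lower-rank function. Vectors are functions on all of
  \<open>nat\<close>, so dependence on the coordinates \<open>1..m\<close> alone has to be recorded
  explicitly.\<close>

locale tame_function =
  fixes m :: nat and V :: "(nat \<Rightarrow> real) \<Rightarrow> complex"
  assumes cong: "\<And>x z. (\<And>i. i \<in> {1..m} \<Longrightarrow> x i = z i) \<Longrightarrow> V x = V z"
    and measurable_PiM: "V \<in> borel_measurable (\<Pi>\<^sub>M i\<in>{1..m}. borel)"
    and bounded: "\<exists>C\<ge>0. \<exists>b. \<forall>x. (\<forall>i\<in>{1..m}. 0 < x i) \<longrightarrow>
      norm (V x) \<le> C * (\<Prod>i=1..m. add_recip (x i)) ^ b"
begin

text \<open>\<open>Z x\<close> need not be extensional, hence need not lie in the product space;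
  \<open>cong\<close> lets its restriction to \<open>{1..m}\<close> take its place.\<close>

lemma measurable_comp:
  assumes "\<And>i. i \<in> {1..m} \<Longrightarrow> (\<lambda>x. Z x i) \<in> borel_measurable M"
  shows "(\<lambda>x. V (Z x)) \<in> borel_measurable M"
proof -
  have "V (Z x) = V (\<lambda>i\<in>{1..m}. Z x i)" for x
    by (rule cong) simp
  moreover have "(\<lambda>x. \<lambda>i\<in>{1..m}. Z x i) \<in> M \<rightarrow>\<^sub>M (\<Pi>\<^sub>M i\<in>{1..m}. borel)"
    using assms by (rule measurable_restrict)
  ultimately show ?thesis
    using measurable_compose[OF _ measurable_PiM] by simp
qed

end

lemma measurable_component_mult_haar_on:
  "i \<in> I \<Longrightarrow> (\<lambda>x. x i) \<in> borel_measurable (mult_haar_on I)"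
  using measurable_component_singleton[of i I "\<lambda>_. mult_haar"] by simp

section \<open>The integrand before and after the substitution\<close>

definition whittaker_integrand ::
    "nat \<Rightarrow> complex \<Rightarrow> ((nat \<Rightarrow> real) \<Rightarrow> complex) \<Rightarrow> (nat \<Rightarrow> real) \<Rightarrow> (nat \<Rightarrow> real) \<Rightarrow> (nat \<Rightarrow> real) \<Rightarrow> complex" where
  "whittaker_integrand n s V y t u =
        (\<Prod>i=1..n. of_real (exp (- (pi * y i)\<^sup>2 * t i - 1 / t i)))
      * (\<Prod>i=1..n. of_real (pi * y i) powr (2 * s))
      * (\<Prod>i=1..n-1. of_real (exp (- (pi * y i)\<^sup>2 * (t i / t (i + 1)) * u i - 1 / u i)))
      * of_real (t 1) powr (2 * s)
      * (\<Prod>i=1..n-1. of_real (t (i + 1) * u i) powr s)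
      * V (\<lambda>i. if i \<le> n - 2
               then y (i + 1) * sqrt (t (i + 1) * u (i + 1) / (t (i + 2) * u i))
               else y n * sqrt (t n / u (n - 1)))"

lemma whittaker_step_eq:
  "whittaker_step n s V y =
     (\<integral>t. (\<integral>u. whittaker_integrand n s V y t u \<partial>mult_haar_on {1..n-1}) \<partial>mult_haar_on {1..n})"
  by (simp only: whittaker_step_def whittaker_integrand_def)

text \<open>All three vectors may vary with a point of an arbitrary space, so one lemma covers fixed
  \<open>t\<close>, pairs \<open>(t, u)\<close>, and the joint dependence on \<open>y\<close> that
  the recursion requires.\<close>

lemma whittaker_integrand_measurable:
  assumes n: "2 \<le> n" and V: "tame_function (n - 1) V"
    and y: "\<And>i. i \<in> {1..n} \<Longrightarrow> (\<lambda>x. y x i) \<in> borel_measurable M"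
    and t: "\<And>i. i \<in> {1..n} \<Longrightarrow> (\<lambda>x. t x i) \<in> borel_measurable M"
    and u: "\<And>i. i \<in> {1..n-1} \<Longrightarrow> (\<lambda>x. u x i) \<in> borel_measurable M"
  shows "(\<lambda>x. whittaker_integrand n s V (y x) (t x) (u x)) \<in> borel_measurable M"
proof -
  have y': "(\<lambda>x. y x i) \<in> borel_measurable M" if "1 \<le> i" "i \<le> n" for i
    using y[of i] that by auto
  have t': "(\<lambda>x. t x i) \<in> borel_measurable M" if "1 \<le> i" "i \<le> n" for i
    using t[of i] that by auto
  have u': "(\<lambda>x. u x i) \<in> borel_measurable M" if "1 \<le> i" "i \<le> n - 1" for i
    using u[of i] that by auto
  have "(\<lambda>x. V (\<lambda>i. if i \<le> n - 2
               then y x (i + 1) * sqrt (t x (i + 1) * u x (i + 1) / (t x (i + 2) * u x i))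
               else y x n * sqrt (t x n / u x (n - 1)))) \<in> borel_measurable M"
  proof (rule tame_function.measurable_comp[OF V])
    fix i assume i: "i \<in> {1..n-1}"
    show "(\<lambda>x. if i \<le> n - 2
               then y x (i + 1) * sqrt (t x (i + 1) * u x (i + 1) / (t x (i + 2) * u x i))
               else y x n * sqrt (t x n / u x (n - 1))) \<in> borel_measurable M"
    proof (cases "i \<le> n - 2")
      case True
      with i have [measurable]: "(\<lambda>x. y x (i + 1)) \<in> borel_measurable M" "(\<lambda>x. t x (i + 1)) \<in> borel_measurable M"
        "(\<lambda>x. t x (i + 2)) \<in> borel_measurable M" "(\<lambda>x. u x (i + 1)) \<in> borel_measurable M"
        "(\<lambda>x. u x i) \<in> borel_measurable M"
        by (auto intro!: y' t' u')
      show ?thesis unfolding if_P[OF True] by measurable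
    next
      case False
      from n have [measurable]: "(\<lambda>x. y x n) \<in> borel_measurable M" "(\<lambda>x. t x n) \<in> borel_measurable M"
        "(\<lambda>x. u x (n - 1)) \<in> borel_measurable M"
        by (auto intro!: y' t' u')
      show ?thesis unfolding if_not_P[OF False] by measurable
    qed
  qed
  moreover have "(\<lambda>x. \<Prod>i=1..n. complex_of_real (exp (- (pi * y x i)\<^sup>2 * t x i - 1 / t x i))) \<in> borel_measurable M"
  proof (rule borel_measurable_prod)
    fix i assume "i \<in> {1..n}"
    note [measurable] = y[OF this] t[OF this]
    show "(\<lambda>x. complex_of_real (exp (- (pi * y x i)\<^sup>2 * t x i - 1 / t x i))) \<in> borel_measurable M"
      by measurable
  qed
  moreover have "(\<lambda>x. \<Prod>i=1..n. complex_of_real (pi * y x i) powr (2 * s)) \<in> borel_measurable M"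
    by (intro borel_measurable_prod borel_measurable_powr_of_real borel_measurable_times borel_measurable_const y)
  moreover have "(\<lambda>x. \<Prod>i=1..n-1. complex_of_real (exp (- (pi * y x i)\<^sup>2 * (t x i / t x (i + 1)) * u x i - 1 / u x i))) \<in> borel_measurable M"
  proof (rule borel_measurable_prod)
    fix i assume i: "i \<in> {1..n-1}"
    then have [measurable]: "(\<lambda>x. y x i) \<in> borel_measurable M" "(\<lambda>x. t x i) \<in> borel_measurable M"
      "(\<lambda>x. t x (i + 1)) \<in> borel_measurable M"
      by (auto intro!: y' t')
    note [measurable] = u[OF i]
    show "(\<lambda>x. complex_of_real (exp (- (pi * y x i)\<^sup>2 * (t x i / t x (i + 1)) * u x i - 1 / u x i)))
        \<in> borel_measurable M"
      by measurable
  qed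
  moreover have "(\<lambda>x. complex_of_real (t x 1) powr (2 * s)) \<in> borel_measurable M"
    using n by (intro borel_measurable_powr_of_real t') auto
  moreover have "(\<lambda>x. \<Prod>i=1..n-1. complex_of_real (t x (i + 1) * u x i) powr s) \<in> borel_measurable M"
    by (intro borel_measurable_prod borel_measurable_powr_of_real borel_measurable_times t' u') auto
  ultimately show ?thesis
    unfolding whittaker_integrand_def by (intro borel_measurable_times)
qed

text \<open>The integrand in the new variables: the coordinates of \<open>t\<close> are decoupled.
  \<open>v\<close> comes before \<open>t\<close> because it becomes the outer variable.\<close>

definition unfolded_integrand ::
    "nat \<Rightarrow> complex \<Rightarrow> ((nat \<Rightarrow> real) \<Rightarrow> complex) \<Rightarrow> (nat \<Rightarrow> real) \<Rightarrow> (nat \<Rightarrow> real) \<Rightarrow> (nat \<Rightarrow> real) \<Rightarrow> complex" where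
  "unfolded_integrand n s V y v t =
     (\<Prod>i=1..n. bessel_kernel (coeff_a n y v i) (coeff_b v i) (2 * s) (t i)) *
     (power_factor n s y v * V (lower_args n y v))"

lemma whittaker_integrand_subst:
  assumes n: "2 \<le> n" and V: "tame_function (n - 1) V"
    and t: "\<And>i. i \<in> {1..n} \<Longrightarrow> 0 < t i" and v: "\<And>i. i \<in> {1..n-1} \<Longrightarrow> 0 < v i"
  shows "whittaker_integrand n s V y t (\<lambda>i\<in>{1..n-1}. t (i + 1) / v i) = unfolded_integrand n s V y v t"
proof -
  have n1: "1 \<le> n" using n by simp
  let ?u = "\<lambda>i\<in>{1..n-1}. t (i + 1) / v i"
  have u: "?u i = t (i + 1) / v i" if "i \<in> {1..n-1}" for i
    using that by simp
  have t1: "0 < t (i + 1)" if "i \<in> {1..n-1}" for i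
    using t[of "i + 1"] that n by auto
  \<comment> \<open>Here \<open>t\<close> cancels:
    \<open>t (i + 1) * u (i + 1) / (t (i + 2) * u i)\<close> becomes \<open>v i / v (i + 1)\<close>,
    and \<open>t n / u (n - 1)\<close> becomes \<open>v (n - 1)\<close>.\<close>
  have "V (\<lambda>i. if i \<le> n - 2
               then y (i + 1) * sqrt (t (i + 1) * ?u (i + 1) / (t (i + 2) * ?u i))
               else y n * sqrt (t n / ?u (n - 1))) = V (lower_args n y v)"
  proof (rule tame_function.cong[OF V])
    fix i assume i: "i \<in> {1..n-1}"
    show "(if i \<le> n - 2
               then y (i + 1) * sqrt (t (i + 1) * ?u (i + 1) / (t (i + 2) * ?u i))
               else y n * sqrt (t n / ?u (n - 1))) = lower_args n y v i"
    proof (cases "i \<le> n - 2")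
      case True
      with i n have "i + 1 \<in> {1..n-1}" by auto
      with True i show ?thesis
        using t1[OF i] t1[of "i + 1"] v[OF i] v[of "i + 1"]
        by (simp only: u lower_args_def if_True) (simp add: field_simps)
    next
      case False
      from n have j: "n - 1 \<in> {1..n-1}" by auto
      show ?thesis
        using False t[of n] v[OF j] n
        by (simp only: u[OF j] lower_args_def if_False) (simp add: field_simps)
    qed
  qed
  \<comment> \<open>The inner exponent becomes
    \<open>- (pi * y i)\<^sup>2 * t i / v i - v i / t (i + 1)\<close>. Its first term joins index
    \<open>i\<close> and completes \<open>coeff_a\<close>; its second joins index
    \<open>i + 1\<close> and completes \<open>coeff_b\<close>.\<close>
  moreover have "(\<Prod>i=1..n. complex_of_real (exp (- (pi * y i)\<^sup>2 * t i - 1 / t i))) *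
      (\<Prod>i=1..n-1. of_real (exp (- (pi * y i)\<^sup>2 * (t i / t (i + 1)) * ?u i - 1 / ?u i))) =
      (\<Prod>i=1..n. of_real (exp (- coeff_a n y v i * t i - coeff_b v i / t i)))"
  proof -
    let ?e = "\<lambda>x. complex_of_real (exp x)"
    have "(\<Prod>i=1..n-1. ?e (- (pi * y i)\<^sup>2 * (t i / t (i + 1)) * ?u i - 1 / ?u i)) =
        (\<Prod>i=1..n-1. ?e (- (pi * y i)\<^sup>2 * (t i / v i)) * ?e (- v i / t (i + 1)))"
    proof (rule prod.cong)
      fix i assume i: "i \<in> {1..n-1}"
      have "- (pi * y i)\<^sup>2 * (t i / t (i + 1)) * ?u i - 1 / ?u i =
          - (pi * y i)\<^sup>2 * (t i / v i) + - v i / t (i + 1)"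
        using t1[OF i] v[OF i] unfolding u[OF i] by simp
      then show "?e (- (pi * y i)\<^sup>2 * (t i / t (i + 1)) * ?u i - 1 / ?u i) =
          ?e (- (pi * y i)\<^sup>2 * (t i / v i)) * ?e (- v i / t (i + 1))"
        by (simp only: exp_add of_real_mult)
    qed simp
    also have "\<dots> = (\<Prod>i=1..n-1. ?e (- (pi * y i)\<^sup>2 * (t i / v i))) * (\<Prod>i=1..n-1. ?e (- v i / t (i + 1)))"
      by (rule prod.distrib)
    also have "(\<Prod>i=1..n-1. ?e (- (pi * y i)\<^sup>2 * (t i / v i))) =
        (\<Prod>i=1..n. if i = n then 1 else ?e (- (pi * y i)\<^sup>2 * (t i / v i)))"
      by (rule prod_if_last[OF n1, symmetric])
    also have "(\<Prod>i=1..n-1. ?e (- v i / t (i + 1))) =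
        (\<Prod>i=1..n. if i = 1 then 1 else ?e (- v (i - 1) / t i))"
      using prod_if_first[OF n1, of "\<lambda>i. ?e (- v (i - 1) / t i)"] by simp
    finally have "(\<Prod>i=1..n. ?e (- (pi * y i)\<^sup>2 * t i - 1 / t i)) *
        (\<Prod>i=1..n-1. ?e (- (pi * y i)\<^sup>2 * (t i / t (i + 1)) * ?u i - 1 / ?u i)) =
      (\<Prod>i=1..n. ?e (- (pi * y i)\<^sup>2 * t i - 1 / t i) *
        ((if i = n then 1 else ?e (- (pi * y i)\<^sup>2 * (t i / v i))) * (if i = 1 then 1 else ?e (- v (i - 1) / t i))))"
      by (simp only: prod.distrib)
    also have "\<dots> = (\<Prod>i=1..n. ?e (- coeff_a n y v i * t i - coeff_b v i / t i))"
      by (rule prod.cong)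
         (auto simp: coeff_a_def coeff_b_def algebra_simps add_divide_distrib
            simp flip: exp_add of_real_mult)
    finally show ?thesis .
  qed
  \<comment> \<open>The inner powers supply \<open>t i powr (2 * s)\<close> only for indices from 2
    on; the separate factor in \<open>t 1\<close> fills the gap.\<close>
  moreover have "of_real (t 1) powr (2 * s) * (\<Prod>i=1..n-1. of_real (t (i + 1) * ?u i) powr s) =
      (\<Prod>i=1..n. of_real (t i) powr (2 * s)) * (\<Prod>i=1..n-1. of_real (1 / v i) powr s)"
  proof -
    have "(\<Prod>i=1..n-1. of_real (t (i + 1) * ?u i) powr s) =
        (\<Prod>i=1..n-1. of_real (t (i + 1)) powr (2 * s) * of_real (1 / v i) powr s)"
    proof (rule prod.cong)
      fix i assume i: "i \<in> {1..n-1}"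
      have "t (i + 1) * ?u i = (t (i + 1))\<^sup>2 * (1 / v i)"
        unfolding u[OF i] by (simp add: power2_eq_square)
      then show "of_real (t (i + 1) * ?u i) powr s = of_real (t (i + 1)) powr (2 * s) * of_real (1 / v i) powr s"
        using t1[OF i] v[OF i]
        by (simp only: powr_of_real_double powr_of_real_mult zero_less_power zero_less_divide_1_iff)
    qed simp
    also have "\<dots> = (\<Prod>i=1..n-1. of_real (t (i + 1)) powr (2 * s)) * (\<Prod>i=1..n-1. of_real (1 / v i) powr s)"
      by (rule prod.distrib)
    also have "of_real (t 1) powr (2 * s) * ((\<Prod>i=1..n-1. of_real (t (i + 1)) powr (2 * s)) *
        (\<Prod>i=1..n-1. of_real (1 / v i) powr s)) =
        (of_real (t 1) powr (2 * s) * (\<Prod>i=1..n-1. of_real (t (i + 1)) powr (2 * s))) *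
        (\<Prod>i=1..n-1. of_real (1 / v i) powr s)"
      by (simp only: mult.assoc)
    also have "of_real (t 1) powr (2 * s) * (\<Prod>i=1..n-1. of_real (t (i + 1)) powr (2 * s)) =
        (\<Prod>i=1..n. of_real (t i) powr (2 * s))"
      using prod_if_first[OF n1, of "\<lambda>i. complex_of_real (t i) powr (2 * s)", symmetric] n1
      by (simp add: prod.atLeast_Suc_atMost)
    finally show ?thesis .
  qed
  moreover have "e1 * p * e2 * q1 * q2 * w = e * q * (p * r * w')"
    if "w = w'" "e1 * e2 = e" "q1 * q2 = q * r" for e1 e2 e p q1 q2 q r w w' :: complex
  proof -
    have "e1 * p * e2 * q1 * q2 * w = (e1 * e2) * (q1 * q2) * p * w" by (simp only: mult_ac)
    then show ?thesis unfolding that by (simp only: mult_ac)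
  qed
  ultimately show ?thesis
    unfolding whittaker_integrand_def unfolded_integrand_def bessel_kernel_def power_factor_def
      prod.distrib
    by blast
qed

subsection \<open>Interchanging the integrals\<close>

lemma lower_args_measurable:
  assumes n: "2 \<le> n" and v: "\<And>i. i \<in> {1..n-1} \<Longrightarrow> (\<lambda>x. v x i) \<in> borel_measurable M"
    and i: "i \<in> {1..n-1}"
  shows "(\<lambda>x. lower_args n y (v x) i) \<in> borel_measurable M"
proof (cases "i \<le> n - 2")
  case True
  with i have [measurable]: "(\<lambda>x. v x i) \<in> borel_measurable M" "(\<lambda>x. v x (i + 1)) \<in> borel_measurable M"
    by (auto intro!: v)
  show ?thesis unfolding lower_args_def if_P[OF True] by measurable
next
  case False
  from n have [measurable]: "(\<lambda>x. v x (n - 1)) \<in> borel_measurable M"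
    by (intro v) auto
  show ?thesis unfolding lower_args_def if_not_P[OF False] by measurable
qed

lemma coeff_measurable:
  assumes v: "\<And>i. i \<in> {1..n-1} \<Longrightarrow> (\<lambda>x. v x i) \<in> borel_measurable M" and i: "i \<in> {1..n}"
  shows "(\<lambda>x. coeff_a n y (v x) i) \<in> borel_measurable M" "(\<lambda>x. coeff_b (v x) i) \<in> borel_measurable M"
    "(\<lambda>x. bessel_arg n y (v x) i) \<in> borel_measurable M"
proof -
  have [measurable]: "(\<lambda>x. if i = n then 0 else 1 / v x i) \<in> borel_measurable M"
    using v[of i] i by (cases "i = n") auto
  have [measurable]: "(\<lambda>x. if i = 1 then 0 else v x (i - 1)) \<in> borel_measurable M"
  proof (cases "i = 1")
    case False
    with i have "i - 1 \<in> {1..n-1}" by auto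
    with False show ?thesis using v by simp
  qed simp
  show "(\<lambda>x. coeff_a n y (v x) i) \<in> borel_measurable M" "(\<lambda>x. coeff_b (v x) i) \<in> borel_measurable M"
    "(\<lambda>x. bessel_arg n y (v x) i) \<in> borel_measurable M"
    unfolding coeff_a_def coeff_b_def bessel_arg_def by measurable
qed

lemma unfolded_integrand_measurable:
  assumes n: "2 \<le> n" and V: "tame_function (n - 1) V"
    and v: "\<And>i. i \<in> {1..n-1} \<Longrightarrow> (\<lambda>x. v x i) \<in> borel_measurable M"
    and t: "\<And>i. i \<in> {1..n} \<Longrightarrow> (\<lambda>x. t x i) \<in> borel_measurable M"
  shows "(\<lambda>x. unfolded_integrand n s V y (v x) (t x)) \<in> borel_measurable M"
proof -
  have [measurable]: "(\<lambda>x. V (lower_args n y (v x))) \<in> borel_measurable M"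
    by (rule tame_function.measurable_comp[OF V], rule lower_args_measurable[OF n v])
  have [measurable]: "(\<lambda>x. power_factor n s y (v x)) \<in> borel_measurable M"
    unfolding power_factor_def
    by (intro borel_measurable_times borel_measurable_const borel_measurable_prod
        borel_measurable_powr_of_real borel_measurable_divide v)
  have [measurable]: "(\<lambda>x. \<Prod>i=1..n. bessel_kernel (coeff_a n y (v x) i) (coeff_b (v x) i) (2 * s) (t x i))
      \<in> borel_measurable M"
  proof (rule borel_measurable_prod)
    fix i assume i: "i \<in> {1..n}"
    note [measurable] = coeff_measurable(1,2)[OF v i] t[OF i]
    show "(\<lambda>x. bessel_kernel (coeff_a n y (v x) i) (coeff_b (v x) i) (2 * s) (t x i)) \<in> borel_measurable M"
      unfolding bessel_kernel_def by measurable
  qed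
  show ?thesis unfolding unfolded_integrand_def by measurable
qed

lemma folded_integrand_measurable:
  assumes n: "2 \<le> n" and V: "tame_function (n - 1) V"
  shows "(\<lambda>v. (\<Prod>i=1..n. bessel_K r (bessel_arg n y v i)) * V (lower_args n y v))
    \<in> borel_measurable (mult_haar_on {1..n-1})"
proof -
  have "(\<lambda>v. V (lower_args n y v)) \<in> borel_measurable (mult_haar_on {1..n-1})"
    by (rule tame_function.measurable_comp[OF V], rule lower_args_measurable[OF n])
       (rule measurable_component_mult_haar_on)
  moreover have "(\<lambda>v. \<Prod>i=1..n. bessel_K r (bessel_arg n y v i)) \<in> borel_measurable (mult_haar_on {1..n-1})"
    by (intro borel_measurable_prod measurable_compose[OF _ bessel_K_measurable] coeff_measurable(3)
        measurable_component_mult_haar_on)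
  ultimately show ?thesis by (rule borel_measurable_times[rotated])
qed

text \<open>The Bessel product decays in \<open>v\<close> faster than the lower-rank function can
  grow. Uniformity in \<open>y\<close> lets the same bound give both integrability and the growth
  estimate at the next rank.\<close>

lemma folded_integrand_bound:
  assumes n: "2 \<le> n" and V: "tame_function (n - 1) V"
  shows "\<exists>C\<ge>0. \<exists>b. \<forall>y v. (\<forall>i\<in>{1..n}. 0 < y i) \<longrightarrow> (\<forall>i\<in>{1..n-1}. 0 < v i) \<longrightarrow>
    norm ((\<Prod>i=1..n. bessel_K r (bessel_arg n y v i)) * V (lower_args n y v)) \<le>
      C * (\<Prod>i=1..n. add_recip (y i)) ^ b * (\<Prod>i=1..n-1. 1 / add_recip (v i))"
proof -
  obtain C b where C: "0 \<le> C" and Vb: "\<And>x. (\<And>i. i \<in> {1..n-1} \<Longrightarrow> 0 < x i) \<Longrightarrow>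
      norm (V x) \<le> C * (\<Prod>i=1..n-1. add_recip (x i)) ^ b"
    using tame_function.bounded[OF V] by blast
  define d where "d = (n - 1) * b"
  obtain p :: nat where p: "\<bar>Re r\<bar> + 1 \<le> real p"
    using real_arch_simple by blast
  \<comment> \<open>\<open>p\<close> makes the Bessel estimate applicable, \<open>2 * d\<close>
    absorbs the growth \<open>W ^ (2 * d)\<close> of \<open>V\<close>, and the final 1 leaves the
    integrable factor \<open>1 / W\<close>.\<close>
  define M where "M = p + 2 * d + 1"
  have "\<bar>Re r\<bar> + 1 \<le> real (2 * M)"
    using p by (simp add: M_def)
  from prod_bessel_K_le[OF _ this, of n, OF order_trans[OF one_le_numeral n]] obtain D where D: "0 \<le> D"
    and Kb: "\<forall>y v. (\<forall>i\<in>{1..n}. 0 < y i) \<longrightarrow> (\<forall>i\<in>{1..n-1}. 0 < v i) \<longrightarrow>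
      norm (\<Prod>i=1..n. bessel_K r (bessel_arg n y v i)) \<le>
      D * (\<Prod>i=1..n. add_recip (y i)) ^ (2 * M) / (\<Prod>i=1..n-1. add_recip (v i)) ^ M"
    by blast
  show ?thesis
  proof (intro exI[of _ "D * C"] exI[of _ "2 * M + d"] conjI allI impI)
    show "0 \<le> D * C" using C D by simp
    fix y v :: "nat \<Rightarrow> real"
    assume yv: "\<forall>i\<in>{1..n}. 0 < y i" "\<forall>i\<in>{1..n-1}. 0 < v i"
    then have y: "\<And>i. i \<in> {1..n} \<Longrightarrow> 0 < y i" and v: "\<And>i. i \<in> {1..n-1} \<Longrightarrow> 0 < v i"
      by auto
    define Y where "Y = (\<Prod>i=1..n. add_recip (y i))"
    define W where "W = (\<Prod>i=1..n-1. add_recip (v i))"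
    have Y: "1 \<le> Y" and W: "1 \<le> W"
      unfolding Y_def W_def using y v by (auto intro!: prod_add_recip_ge_1)
    \<comment> \<open>Each of the \<open>n - 1\<close> arguments costs at most
      \<open>Y * W\<^sup>2\<close>; raised to the power \<open>b\<close> this explains
      \<open>d = (n - 1) * b\<close>.\<close>
    have "(\<Prod>i=1..n-1. add_recip (lower_args n y v i)) \<le> (\<Prod>i=1..n-1. Y * W\<^sup>2)"
      unfolding Y_def W_def
      using add_recip_lower_args_le[of n y v, OF n y v] add_recip_pos[OF lower_args_pos[of n y v, OF n y v]]
      by (intro prod_mono) (auto simp: less_imp_le)
    then have "(\<Prod>i=1..n-1. add_recip (lower_args n y v i)) ^ b \<le> ((Y * W\<^sup>2) ^ (n - 1)) ^ b"
      using add_recip_pos[OF lower_args_pos[of n y v, OF n y v]]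
      by (intro power_mono) (auto intro!: prod_nonneg simp: less_imp_le)
    also have "\<dots> = Y ^ d * W ^ (2 * d)"
      by (simp add: d_def power_mult_distrib flip: power_mult)
         (simp add: mult.assoc)
    finally have "norm (V (lower_args n y v)) \<le> C * (Y ^ d * W ^ (2 * d))"
      using Vb[OF lower_args_pos[of n y v, OF n y v]] C by (meson mult_left_mono order_trans)
    moreover have "norm (\<Prod>i=1..n. bessel_K r (bessel_arg n y v i)) \<le> D * Y ^ (2 * M) / W ^ M"
      unfolding Y_def W_def by (rule Kb[THEN spec, THEN spec, THEN mp, THEN mp, OF yv])
    ultimately have "norm ((\<Prod>i=1..n. bessel_K r (bessel_arg n y v i)) * V (lower_args n y v)) \<le>
        (D * Y ^ (2 * M) / W ^ M) * (C * (Y ^ d * W ^ (2 * d)))"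
      unfolding norm_mult using D Y W by (intro mult_mono) auto
    also have "\<dots> = D * C * Y ^ (2 * M + d) * (W ^ (2 * d) / W ^ M)"
      by (simp add: power_add)
    also have "\<dots> \<le> D * C * Y ^ (2 * M + d) * (1 / W)"
    proof (intro mult_left_mono)
      have "W ^ (2 * d) * W \<le> W ^ M"
        using W power_increasing[of "2 * d + 1" M W] by (simp add: M_def)
      then show "W ^ (2 * d) / W ^ M \<le> 1 / W"
        using W by (simp add: field_simps)
    qed (use D C Y in auto)
    finally show "norm ((\<Prod>i=1..n. bessel_K r (bessel_arg n y v i)) * V (lower_args n y v)) \<le>
      D * C * (\<Prod>i=1..n. add_recip (y i)) ^ (2 * M + d) * (\<Prod>i=1..n-1. 1 / add_recip (v i))"
      by (simp add: Y_def W_def prod_dividef)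
  qed
qed

section \<open>Absolute convergence\<close>

lemma integrable_prod_inverse_add_recip:
  "integrable (mult_haar_on {1..m}) (\<lambda>v. \<Prod>i=1..m. 1 / add_recip (v i))"
  unfolding add_recip_def
  by (rule mult_haar_prod.product_integrable_prod) (auto intro: integrable_mult_haar_inverse)

lemma integrable_folded_integrand:
  assumes n: "2 \<le> n" and V: "tame_function (n - 1) V" and y: "\<And>i. i \<in> {1..n} \<Longrightarrow> 0 < y i"
  shows "integrable (mult_haar_on {1..n-1})
    (\<lambda>v. (\<Prod>i=1..n. bessel_K r (bessel_arg n y v i)) * V (lower_args n y v))"
proof -
  obtain C b where *: "\<And>v. (\<forall>i\<in>{1..n-1}. 0 < v i) \<Longrightarrow>
    norm ((\<Prod>i=1..n. bessel_K r (bessel_arg n y v i)) * V (lower_args n y v)) \<le>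
      C * (\<Prod>i=1..n. add_recip (y i)) ^ b * (\<Prod>i=1..n-1. 1 / add_recip (v i))"
    using folded_integrand_bound[OF n V, of r] y by blast
  show ?thesis
  proof (rule Bochner_Integration.integrable_bound)
    show "integrable (mult_haar_on {1..n-1})
        (\<lambda>v. C * (\<Prod>i=1..n. add_recip (y i)) ^ b * (\<Prod>i=1..n-1. 1 / add_recip (v i)))"
      by (intro integrable_mult_right integrable_prod_inverse_add_recip)
    show "AE v in mult_haar_on {1..n-1}.
        norm ((\<Prod>i=1..n. bessel_K r (bessel_arg n y v i)) * V (lower_args n y v)) \<le>
        norm (C * (\<Prod>i=1..n. add_recip (y i)) ^ b * (\<Prod>i=1..n-1. 1 / add_recip (v i)))"
      using AE_mult_haar_on_pos[of "{1..n-1}", OF finite_atLeastAtMost]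
    proof eventually_elim
      case (elim v)
      show ?case using *[OF elim] unfolding real_norm_def by linarith
    qed
  qed (rule folded_integrand_measurable[OF n V])
qed

text \<open>The absolute value of a complex power of a positive real depends only on the real part
  of the exponent.\<close>

lemma norm_power_factor:
  assumes "\<And>i. i \<in> {1..n} \<Longrightarrow> 0 < y i" "\<And>i. i \<in> {1..n-1} \<Longrightarrow> 0 < v i"
  shows "norm (power_factor n s y v) = norm (power_factor n (of_real (Re s)) y v)"
proof -
  have pos: "norm (complex_of_real a powr z) = a powr Re z" if "0 < a" for a z
    using that by (simp add: norm_powr_real_powr)
  have "norm (complex_of_real (pi * y i) powr (2 * s)) =
      norm (complex_of_real (pi * y i) powr (2 * of_real (Re s)))" if "i \<in> {1..n}" for i
    using assms(1)[OF that] by (subst (1 2) pos) auto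
  moreover have "norm (complex_of_real (1 / v i) powr s) =
      norm (complex_of_real (1 / v i) powr of_real (Re s))" if "i \<in> {1..n-1}" for i
    using assms(2)[OF that] by (subst (1 2) pos) auto
  ultimately show ?thesis
    unfolding power_factor_def norm_mult prod_norm[symmetric]
    by (intro arg_cong2[of _ _ _ _ "(*)"] prod.cong refl)
qed

lemma integrable_unfolded_slice:
  assumes n: "2 \<le> n" and y: "\<And>i. i \<in> {1..n} \<Longrightarrow> 0 < y i" and v: "\<And>i. i \<in> {1..n-1} \<Longrightarrow> 0 < v i"
  shows "integrable (mult_haar_on {1..n}) (unfolded_integrand n s V y v)"
proof -
  have n1: "1 \<le> n" using n by simp
  show ?thesis
    unfolding unfolded_integrand_def
    by (intro integrable_mult_left mult_haar_prod.product_integrable_prod integrable_bessel_kernel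
        coeff_a_pos[of n y v, OF n1 y v] coeff_b_pos[of n v, OF v]) auto
qed

lemma integral_unfolded_slice:
  assumes n: "2 \<le> n" and y: "\<And>i. i \<in> {1..n} \<Longrightarrow> 0 < y i" and v: "\<And>i. i \<in> {1..n-1} \<Longrightarrow> 0 < v i"
  shows "(\<integral>t. unfolded_integrand n s V y v t \<partial>mult_haar_on {1..n}) =
    2 ^ n * ((\<Prod>i=1..n. bessel_K (2 * s) (bessel_arg n y v i)) * V (lower_args n y v))"
proof -
  have n1: "1 \<le> n" using n by simp
  have "(\<integral>t. unfolded_integrand n s V y v t \<partial>mult_haar_on {1..n}) =
      (\<integral>t. (\<Prod>i=1..n. bessel_kernel (coeff_a n y v i) (coeff_b v i) (2 * s) (t i)) \<partial>mult_haar_on {1..n}) *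
      (power_factor n s y v * V (lower_args n y v))"
    unfolding unfolded_integrand_def by (rule integral_mult_left_zero)
  also have "(\<integral>t. (\<Prod>i=1..n. bessel_kernel (coeff_a n y v i) (coeff_b v i) (2 * s) (t i)) \<partial>mult_haar_on {1..n}) =
      (\<Prod>i=1..n. \<integral>t. bessel_kernel (coeff_a n y v i) (coeff_b v i) (2 * s) t \<partial>mult_haar)"
    by (intro mult_haar_prod.product_integral_prod integrable_bessel_kernel
        coeff_a_pos[of n y v, OF n1 y v] coeff_b_pos[of n v, OF v]) auto
  finally show ?thesis
    using prod_integral_bessel_kernel[of n y v s, OF n1 y v] by (simp only: mult.assoc[symmetric])
qed

text \<open>Taking absolute values amounts to replacing \<open>s\<close> by \<open>Re s\<close> in
  kernels and powers, so the closed evaluation applies once more, with Bessel functions of real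
  order.\<close>

lemma integral_norm_unfolded_slice:
  assumes n: "2 \<le> n" and y: "\<And>i. i \<in> {1..n} \<Longrightarrow> 0 < y i" and v: "\<And>i. i \<in> {1..n-1} \<Longrightarrow> 0 < v i"
  shows "(\<integral>t. norm (unfolded_integrand n s V y v t) \<partial>mult_haar_on {1..n}) =
    2 ^ n * norm ((\<Prod>i=1..n. bessel_K (2 * of_real (Re s)) (bessel_arg n y v i)) * V (lower_args n y v))"
proof -
  have n1: "1 \<le> n" using n by simp
  let ?k = "\<lambda>z i. bessel_kernel (coeff_a n y v i) (coeff_b v i) (2 * z)"
  let ?\<sigma> = "complex_of_real (Re s)"
  have "(\<integral>t. norm (unfolded_integrand n s V y v t) \<partial>mult_haar_on {1..n}) =
      (\<integral>t. (\<Prod>i=1..n. norm (?k s i (t i))) \<partial>mult_haar_on {1..n}) *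
      norm (power_factor n s y v * V (lower_args n y v))"
    unfolding unfolded_integrand_def norm_mult[of "prod _ _"] prod_norm[symmetric]
    by (rule integral_mult_left_zero)
  also have "(\<integral>t. (\<Prod>i=1..n. norm (?k s i (t i))) \<partial>mult_haar_on {1..n}) =
      (\<Prod>i=1..n. \<integral>t. norm (?k s i t) \<partial>mult_haar)"
    by (intro mult_haar_prod.product_integral_prod integrable_norm integrable_bessel_kernel
        coeff_a_pos[of n y v, OF n1 y v] coeff_b_pos[of n v, OF v]) auto
  also have "\<dots> = norm (\<Prod>i=1..n. \<integral>t. ?k ?\<sigma> i t \<partial>mult_haar)"
    unfolding integral_norm_bessel_kernel prod_norm[symmetric] by simp
  also have "\<dots> * norm (power_factor n s y v * V (lower_args n y v)) =
      norm ((\<Prod>i=1..n. \<integral>t. ?k ?\<sigma> i t \<partial>mult_haar) * power_factor n ?\<sigma> y v) * norm (V (lower_args n y v))"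
    by (simp only: norm_mult norm_power_factor[of n y v s, OF y v] mult.assoc)
  also have "\<dots> = norm (2 ^ n * (\<Prod>i=1..n. bessel_K (2 * ?\<sigma>) (bessel_arg n y v i))) * norm (V (lower_args n y v))"
    by (simp only: prod_integral_bessel_kernel[of n y v, OF n1 y v])
  finally show ?thesis
    by (simp only: norm_mult norm_power norm_numeral mult.assoc)
qed

text \<open>Integrating absolute values over \<open>t\<close> first gives a closed form, which is
  then integrable in \<open>v\<close> by the case of real order.\<close>

lemma integrable_unfolded_integrand:
  assumes n: "2 \<le> n" and V: "tame_function (n - 1) V" and y: "\<And>i. i \<in> {1..n} \<Longrightarrow> 0 < y i"
  shows "integrable (mult_haar_on {1..n-1} \<Otimes>\<^sub>M mult_haar_on {1..n})
    (\<lambda>(v, t). unfolded_integrand n s V y v t)"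
proof -
  let ?J = "mult_haar_on {1..n-1}" and ?I = "mult_haar_on {1..n}"
  interpret J: sigma_finite_measure ?J by (rule sigma_finite_mult_haar_on) simp
  interpret I: sigma_finite_measure ?I by (rule sigma_finite_mult_haar_on) simp
  interpret P: pair_sigma_finite ?J ?I by unfold_locales
  note pos = AE_mult_haar_on_pos[of "{1..n-1}", OF finite_atLeastAtMost]
  have meas [measurable]: "(\<lambda>(v, t). unfolded_integrand n s V y v t) \<in> borel_measurable (?J \<Otimes>\<^sub>M ?I)"
    unfolding case_prod_beta
    by (rule unfolded_integrand_measurable[OF n V])
       (auto intro!: measurable_compose[OF measurable_fst] measurable_compose[OF measurable_snd]
         measurable_component_mult_haar_on)
  show ?thesis
  proof (rule P.Fubini_integrable[OF meas])
    let ?g = "\<lambda>v. (\<Prod>i=1..n. bessel_K (2 * of_real (Re s)) (bessel_arg n y v i)) * V (lower_args n y v)"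
    have "integrable ?J (\<lambda>v. 2 ^ n * norm (?g v))"
      by (intro integrable_mult_right integrable_norm integrable_folded_integrand[of n V y, OF n V y])
    then show "integrable ?J (\<lambda>v. \<integral>t. norm (case (v, t) of (v, t) \<Rightarrow> unfolded_integrand n s V y v t) \<partial>?I)"
    proof (rule integrable_cong_AE_imp)
      show "AE v in ?J. 2 ^ n * norm (?g v) =
          (\<integral>t. norm (case (v, t) of (v, t) \<Rightarrow> unfolded_integrand n s V y v t) \<partial>?I)"
        using pos by eventually_elim (unfold prod.case, (rule integral_norm_unfolded_slice[of n y, OF n y, symmetric]; blast))
    qed measurable
    show "AE v in ?J. integrable ?I (\<lambda>t. case (v, t) of (v, t) \<Rightarrow> unfolded_integrand n s V y v t)"
      using pos by eventually_elim (unfold prod.case, (rule integrable_unfolded_slice[of n y, OF n y]; blast))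
  qed
qed

text \<open>The measure is replaced by its equal image under \<open>?T\<close>.
  \<open>integral_distr\<close> rests on measurability, so convergence enters only at the
  interchange.\<close>

lemma inner_integral_subst:
  assumes n: "2 \<le> n" and V: "tame_function (n - 1) V" and t: "\<And>i. i \<in> {1..n} \<Longrightarrow> 0 < t i"
  shows "(\<integral>u. whittaker_integrand n s V y t u \<partial>mult_haar_on {1..n-1}) =
    (\<integral>v. unfolded_integrand n s V y v t \<partial>mult_haar_on {1..n-1})"
proof -
  let ?J = "mult_haar_on {1..n-1}"
  let ?T = "\<lambda>v::nat \<Rightarrow> real. \<lambda>i\<in>{1..n-1}. t (i + 1) / v i"
  have t1: "0 < t (i + 1)" if "i \<in> {1..n-1}" for i
    using t[of "i + 1"] that n by auto
  have wi: "whittaker_integrand n s V y t \<in> borel_measurable ?J"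
    by (rule whittaker_integrand_measurable[OF n V]) (auto intro: measurable_component_mult_haar_on)
  have uf: "(\<lambda>v. unfolded_integrand n s V y v t) \<in> borel_measurable ?J"
    by (rule unfolded_integrand_measurable[OF n V]) (auto intro: measurable_component_mult_haar_on)
  have T: "?T \<in> ?J \<rightarrow>\<^sub>M ?J"
    by (rule measurable_restrict) simp
  have "(\<integral>u. whittaker_integrand n s V y t u \<partial>?J) =
      (\<integral>u. whittaker_integrand n s V y t u \<partial>distr ?J ?J ?T)"
    using distr_mult_haar_on_divide[of "{1..n-1}" "\<lambda>i. t (i + 1)"] t1 by simp
  also have "\<dots> = (\<integral>v. whittaker_integrand n s V y t (?T v) \<partial>?J)"
    by (rule integral_distr[OF T wi])
  also have "\<dots> = (\<integral>v. unfolded_integrand n s V y v t \<partial>?J)"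
  proof (rule integral_cong_AE[OF measurable_compose[OF T wi] uf])
    show "AE v in ?J. whittaker_integrand n s V y t (?T v) = unfolded_integrand n s V y v t"
      using AE_mult_haar_on_pos[of "{1..n-1}", OF finite_atLeastAtMost]
      by eventually_elim (rule whittaker_integrand_subst[of n V t, OF n V t]; blast)
  qed
  finally show ?thesis .
qed

text \<open>Stated for every tame \<open>V\<close>, since it serves twice: for the theorem itself
  and for the growth bound that keeps the recursion going.\<close>

lemma whittaker_step_eq_integral_bessel_K:
  assumes n: "2 \<le> n" and V: "tame_function (n - 1) V" and y: "\<And>i. i \<in> {1..n} \<Longrightarrow> 0 < y i"
  shows "whittaker_step n s V y = 2 ^ n *
    (\<integral>v. (\<Prod>i=1..n. bessel_K (2 * s) (bessel_arg n y v i)) * V (lower_args n y v) \<partial>mult_haar_on {1..n-1})"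
proof -
  let ?J = "mult_haar_on {1..n-1}" and ?I = "mult_haar_on {1..n}"
  let ?g = "\<lambda>v. (\<Prod>i=1..n. bessel_K (2 * s) (bessel_arg n y v i)) * V (lower_args n y v)"
  interpret J: sigma_finite_measure ?J by (rule sigma_finite_mult_haar_on) simp
  interpret I: sigma_finite_measure ?I by (rule sigma_finite_mult_haar_on) simp
  interpret P: pair_sigma_finite ?J ?I by unfold_locales
  note int = integrable_unfolded_integrand[of n V y s, OF n V y]
  have [measurable]: "(\<lambda>(t, v). unfolded_integrand n s V y v t) \<in> borel_measurable (?I \<Otimes>\<^sub>M ?J)"
    "(\<lambda>(v, t). unfolded_integrand n s V y v t) \<in> borel_measurable (?J \<Otimes>\<^sub>M ?I)"
    "(\<lambda>(t, u). whittaker_integrand n s V y t u) \<in> borel_measurable (?I \<Otimes>\<^sub>M ?J)"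
    unfolding case_prod_beta
    by (rule unfolded_integrand_measurable[OF n V] whittaker_integrand_measurable[OF n V];
        auto intro!: measurable_compose[OF measurable_fst] measurable_compose[OF measurable_snd]
         measurable_component_mult_haar_on)+
  have "whittaker_step n s V y = (\<integral>t. (\<integral>u. whittaker_integrand n s V y t u \<partial>?J) \<partial>?I)"
    by (rule whittaker_step_eq)
  also have "\<dots> = (\<integral>t. (\<integral>v. unfolded_integrand n s V y v t \<partial>?J) \<partial>?I)"
  proof (rule integral_cong_AE)
    show "AE t in ?I. (\<integral>u. whittaker_integrand n s V y t u \<partial>?J) =
        (\<integral>v. unfolded_integrand n s V y v t \<partial>?J)"
      using AE_mult_haar_on_pos[of "{1..n}", OF finite_atLeastAtMost]
      by eventually_elim (rule inner_integral_subst[OF n V]; blast)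
  qed measurable
  \<comment> \<open>The interchange takes place only after the substitution, where absolute
    integrability on the product is known.\<close>
  also have "\<dots> = (\<integral>v. (\<integral>t. unfolded_integrand n s V y v t \<partial>?I) \<partial>?J)"
    by (rule P.Fubini_integral[OF int])
  also have "\<dots> = (\<integral>v. 2 ^ n * ?g v \<partial>?J)"
  proof (rule integral_cong_AE)
    show "AE v in ?J. (\<integral>t. unfolded_integrand n s V y v t \<partial>?I) = 2 ^ n * ?g v"
      using AE_mult_haar_on_pos[of "{1..n-1}", OF finite_atLeastAtMost]
      by eventually_elim (rule integral_unfolded_slice[of n y, OF n y]; blast)
    show "(\<lambda>v. 2 ^ n * ?g v) \<in> borel_measurable ?J"
      by (rule borel_measurable_times[OF borel_measurable_const folded_integrand_measurable[OF n V]])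
  qed measurable
  also have "\<dots> = 2 ^ n * (\<integral>v. ?g v \<partial>?J)"
    by (rule integral_mult_right_zero)
  finally show ?thesis .
qed

section \<open>Tameness at every rank\<close>

lemma whittaker_integrand_cong:
  assumes n: "2 \<le> n" and V: "tame_function (n - 1) V" and eq: "\<And>i. i \<in> {1..n} \<Longrightarrow> y i = y' i"
  shows "whittaker_integrand n s V y = whittaker_integrand n s V y'"
proof (intro ext)
  fix t u
  have "V (\<lambda>i. if i \<le> n - 2 then y (i + 1) * sqrt (t (i + 1) * u (i + 1) / (t (i + 2) * u i))
               else y n * sqrt (t n / u (n - 1))) =
      V (\<lambda>i. if i \<le> n - 2 then y' (i + 1) * sqrt (t (i + 1) * u (i + 1) / (t (i + 2) * u i))
               else y' n * sqrt (t n / u (n - 1)))"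
    by (rule tame_function.cong[OF V]) (use n eq in auto)
  then show "whittaker_integrand n s V y t u = whittaker_integrand n s V y' t u"
    unfolding whittaker_integrand_def using eq
    by (intro arg_cong2[of _ _ _ _ "(*)"] prod.cong refl) auto
qed

text \<open>The growth bound is read off the Bessel formula rather than the original double
  integral: integrating the uniform majorant in \<open>v\<close> leaves a power of the weights of
  \<open>y\<close>.\<close>

lemma tame_function_whittaker_step:
  assumes n: "2 \<le> n" and V: "tame_function (n - 1) V"
  shows "tame_function n (whittaker_step n s V)"
proof
  fix y y' :: "nat \<Rightarrow> real"
  assume "\<And>i. i \<in> {1..n} \<Longrightarrow> y i = y' i"
  from whittaker_integrand_cong[OF n V this]
  show "whittaker_step n s V y = whittaker_step n s V y'"
    by (simp only: whittaker_step_eq)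
next
  let ?J = "mult_haar_on {1..n-1}" and ?I = "mult_haar_on {1..n}"
  let ?M = "\<Pi>\<^sub>M i\<in>{1..n}. (borel :: real measure)"
  interpret J: sigma_finite_measure ?J by (rule sigma_finite_mult_haar_on) simp
  interpret I: sigma_finite_measure ?I by (rule sigma_finite_mult_haar_on) simp
  \<comment> \<open>The pair \<open>p\<close> holds \<open>y\<close> and \<open>t\<close>:
    integrating out \<open>u\<close>, then \<open>t\<close>, keeps measurability in the remaining
    variables.\<close>
  have "(\<lambda>(p, u). whittaker_integrand n s V (fst p) (snd p) u) \<in> borel_measurable ((?M \<Otimes>\<^sub>M ?I) \<Otimes>\<^sub>M ?J)"
    unfolding case_prod_beta
    by (rule whittaker_integrand_measurable[OF n V])
       (auto intro!: measurable_compose[OF measurable_fst] measurable_compose[OF measurable_snd]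
         measurable_component_mult_haar_on measurable_component_singleton)
  from J.borel_measurable_lebesgue_integral[OF this]
  have "(\<lambda>(y, t). \<integral>u. whittaker_integrand n s V y t u \<partial>?J) \<in> borel_measurable (?M \<Otimes>\<^sub>M ?I)"
    by (simp only: split_beta')
  then show "whittaker_step n s V \<in> borel_measurable ?M"
    unfolding whittaker_step_eq[abs_def] by (rule I.borel_measurable_lebesgue_integral)
next
  obtain C b where C: "0 \<le> C" and *: "\<And>y v. (\<forall>i\<in>{1..n}. 0 < y i) \<Longrightarrow> (\<forall>i\<in>{1..n-1}. 0 < v i) \<Longrightarrow>
    norm ((\<Prod>i=1..n. bessel_K (2 * s) (bessel_arg n y v i)) * V (lower_args n y v)) \<le>
      C * (\<Prod>i=1..n. add_recip (y i)) ^ b * (\<Prod>i=1..n-1. 1 / add_recip (v i))"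
    using folded_integrand_bound[OF n V, of "2 * s"] by blast
  let ?J = "mult_haar_on {1..n-1}"
  define c where "c = (\<integral>v. (\<Prod>i=1..n-1. 1 / add_recip (v i)) \<partial>?J)"
  note pos = AE_mult_haar_on_pos[of "{1..n-1}", OF finite_atLeastAtMost]
  have c: "0 \<le> c"
    unfolding c_def using pos
    by (intro integral_nonneg_AE) (auto elim!: eventually_mono intro!: less_imp_le[OF prod_pos] add_recip_pos)
  show "\<exists>C\<ge>0. \<exists>b. \<forall>y. (\<forall>i\<in>{1..n}. 0 < y i) \<longrightarrow>
      norm (whittaker_step n s V y) \<le> C * (\<Prod>i=1..n. add_recip (y i)) ^ b"
  \<comment> \<open>\<open>2 ^ n\<close> comes from the Bessel formula, \<open>C\<close> and
    \<open>b\<close> from the uniform majorant, and \<open>c\<close> is the integral of its part in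
    \<open>v\<close>.\<close>
  proof (intro exI[of _ "2 ^ n * C * c"] exI[of _ b] conjI allI impI)
    show "0 \<le> 2 ^ n * C * c" using C c by simp
    fix y :: "nat \<Rightarrow> real" assume y: "\<forall>i\<in>{1..n}. 0 < y i"
    let ?g = "\<lambda>v. (\<Prod>i=1..n. bessel_K (2 * s) (bessel_arg n y v i)) * V (lower_args n y v)"
    let ?Y = "\<Prod>i=1..n. add_recip (y i)"
    have "norm (whittaker_step n s V y) = 2 ^ n * norm (\<integral>v. ?g v \<partial>?J)"
      using y by (subst whittaker_step_eq_integral_bessel_K[OF n V]) (auto simp: norm_mult norm_power)
    also have "norm (\<integral>v. ?g v \<partial>?J) \<le> (\<integral>v. norm (?g v) \<partial>?J)"
      by (rule integral_norm_bound)
    also have "\<dots> \<le> (\<integral>v. C * ?Y ^ b * (\<Prod>i=1..n-1. 1 / add_recip (v i)) \<partial>?J)"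
    proof (rule integral_mono_AE)
      show "integrable ?J (\<lambda>v. norm (?g v))"
        using y by (intro integrable_norm integrable_folded_integrand[OF n V]) auto
      show "integrable ?J (\<lambda>v. C * ?Y ^ b * (\<Prod>i=1..n-1. 1 / add_recip (v i)))"
        by (intro integrable_mult_right integrable_prod_inverse_add_recip)
      show "AE v in ?J. norm (?g v) \<le> C * ?Y ^ b * (\<Prod>i=1..n-1. 1 / add_recip (v i))"
        using pos by eventually_elim (rule *[OF y])
    qed
    also have "\<dots> = C * ?Y ^ b * c"
      unfolding c_def by (rule integral_mult_right_zero)
    finally show "norm (whittaker_step n s V y) \<le> 2 ^ n * C * c * ?Y ^ b"
      by (simp add: mult_ac)
  qed
qed

text \<open>The start of the recursion: an inverse power of \<open>y 1\<close> is at most the same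
  power of \<open>add_recip (y 1)\<close>.\<close>

lemma tame_function_bessel_K: "tame_function 1 (\<lambda>y. 2 * bessel_K r (2 * pi * y 1))"
proof
  show "(\<lambda>y::nat \<Rightarrow> real. 2 * bessel_K r (2 * pi * y 1)) \<in> borel_measurable (\<Pi>\<^sub>M i\<in>{1..1}. borel)"
    by (intro borel_measurable_times borel_measurable_const measurable_component_singleton
        measurable_compose[OF _ bessel_K_measurable]) simp
next
  obtain N :: nat where N: "\<bar>Re r\<bar> + 1 \<le> real N"
    using real_arch_simple by blast
  obtain C where C: "0 \<le> C" "\<And>x. 0 < x \<Longrightarrow> norm (bessel_K r x) \<le> C / x ^ N"
    using norm_bessel_K_le[OF N] by blast
  show "\<exists>C\<ge>0. \<exists>b. \<forall>y::nat \<Rightarrow> real. (\<forall>i\<in>{1..1}. 0 < y i) \<longrightarrow>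
      norm (2 * bessel_K r (2 * pi * y 1)) \<le> C * (\<Prod>i=1..1. add_recip (y i)) ^ b"
  proof (intro exI[of _ "2 * C"] exI[of _ N] conjI allI impI)
    fix y :: "nat \<Rightarrow> real" assume "\<forall>i\<in>{1..1}. 0 < y i"
    then have y: "0 < y 1" by simp
    have "norm (bessel_K r (2 * pi * y 1)) \<le> C / (2 * pi * y 1) ^ N"
      using y by (intro C) simp
    also have "\<dots> = C * (1 / (2 * pi * y 1)) ^ N"
      by (simp add: power_divide)
    also have "\<dots> \<le> C * add_recip (y 1) ^ N"
    proof (intro mult_left_mono power_mono C)
      have "1 / (2 * pi * y 1) \<le> 1 / y 1"
        using y pi_ge_two by (intro divide_left_mono) auto
      then show "1 / (2 * pi * y 1) \<le> add_recip (y 1)"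
        using y by (simp add: add_recip_def)
    qed (use y in simp)
    finally show "norm (2 * bessel_K r (2 * pi * y 1)) \<le> 2 * C * (\<Prod>i=1..1. add_recip (y i)) ^ N"
      by (simp add: norm_mult)
  qed (use C in simp)
qed simp

lemma tame_function_whittaker: "1 \<le> n \<Longrightarrow> tame_function n (whittaker n \<nu>)"
proof (induction n rule: dec_induct)
  case base
  have "whittaker 1 \<nu> = (\<lambda>y. 2 * bessel_K (2 * \<nu> 1) (2 * pi * y 1))"
    by (rule ext) simp
  then show ?case by (simp only: tame_function_bessel_K)
next
  case (step n)
  \<comment> \<open>The recursive equation of \<open>whittaker\<close> matches only a double
    successor, so \<open>n\<close> itself is exposed as a successor.\<close>
  then obtain m where m: "n = Suc m" by (cases n) auto
  have "whittaker (Suc n) \<nu> = whittaker_step (Suc n) (\<nu> (Suc n)) (whittaker n \<nu>)"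
    by (rule ext) (simp add: m)
  then show ?case
    using tame_function_whittaker_step[of "Suc n" "whittaker n \<nu>"] step by simp
qed

theorem theorem4p1:
  fixes n :: nat and \<nu> :: "nat \<Rightarrow> complex" and y :: "nat \<Rightarrow> real"
  assumes "n \<ge> 2"
    and "\<And>i. i \<in> {1..n} \<Longrightarrow> y i > 0"
  shows "whittaker n \<nu> y =
    2 ^ n * (\<integral>u.
        (\<Prod>i=1..n. bessel_K (2 * \<nu> n)
           (2 * pi * y i * sqrt ((1 + (if i = 1 then 0 else u (i - 1)))
                               * (1 + (if i = n then 0 else 1 / u i)))))
      * whittaker (n - 1) \<nu>
          (\<lambda>i. if i \<le> n - 2 then y (i + 1) * sqrt (u i / u (i + 1))
               else y n * sqrt (u (n - 1)))
      \<partial>mult_haar_on {1..n-1})"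
proof -
  from assms(1) obtain m where m: "n = Suc (Suc m)"
    by (metis Suc_le_D numeral_2_eq_2 Suc_le_mono)
  have "whittaker n \<nu> y = whittaker_step n (\<nu> n) (whittaker (n - 1) \<nu>) y"
    by (simp add: m)
  also have "\<dots> = 2 ^ n * (\<integral>v. (\<Prod>i=1..n. bessel_K (2 * \<nu> n) (bessel_arg n y v i)) *
      whittaker (n - 1) \<nu> (lower_args n y v) \<partial>mult_haar_on {1..n-1})"
    using assms by (intro whittaker_step_eq_integral_bessel_K tame_function_whittaker) auto
  \<comment> \<open>The abbreviations \<open>bessel_arg\<close> and \<open>lower_args\<close> unfold
    literally to the expressions of the claim.\<close>
  finally show ?thesis
    by (simp only: bessel_arg_def lower_args_def[abs_def])
qed

end
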